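(* Let $\widetilde{H}$ be the affine Hecke algebra of type $G_2$ and assume $q^2\neq1$. Let $\epsilon\in\{1,-1\}$, $t'=t_{\epsilon q,1}$, $t=s_2s_1t'$ (so that $t(X^{\alpha_1})=q^2$ and $t(X^{\alpha_2})=\epsilon q^{-3}$), and $w_0=s_1s_2s_1s_2s_1s_2$. Let $\mathbb{C}v_t$ and $\mathbb{C}v_{w_0t}$ be the $1$-dimensional $\widetilde{H}_{\{1\}}$-modules given by $T_1v_t=qv_t$, $X^\lambda v_t=t(X^\lambda)v_t$, and $T_1v_{w_0t}=-q^{-1}v_{w_0t}$, $X^\lambda v_{w_0t}=(w_0t)(X^\lambda)v_{w_0t}$, and let $M=\widetilde{H}\otimes_{\widetilde{H}_{\{1\}}}\mathbb{C}v_t$ and $N=\widetilde{H}\otimes_{\widetilde{H}_{\{1\}}}\mathbb{C}v_{w_0t}$. Assume that $t'(X^{\alpha_1})\neq q^{-2}$ and $t'(X^{3\alpha_1})\neq q^{-2}$. Then $M$ and $N$ are irreducible.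
   Context: The type $G_2$ root system has simple roots $\alpha_1,\alpha_2$ with $\langle\alpha_1,\alpha_2^\vee\rangle=-1$, $\langle\alpha_2,\alpha_1^\vee\rangle=-3$; $s_i\lambda=\lambda-\langle\lambda,\alpha_i^\vee\rangle\alpha_i$, and $W_0=\langle s_1,s_2\rangle$. $P=\mathbb{Z}\alpha_1+\mathbb{Z}\alpha_2$ is the weight lattice; $X=\{X^\lambda\mid\lambda\in P\}$, $X^\lambda X^\mu=X^{\lambda+\mu}$. For $q\in\mathbb{C}^\times$, $\widetilde{H}$ is the $\mathbb{C}$-algebra generated by $T_1,T_2$ and $X^\lambda$ ($\lambda\in P$), with the group algebra $\mathbb{C}[X]$ a subalgebra, subject to $T_i^2=(q-q^{-1})T_i+1$, $T_1T_2T_1T_2T_1T_2=T_2T_1T_2T_1T_2T_1$, and $X^\lambda T_i=T_iX^{s_i\lambda}+(q-q^{-1})\frac{X^\lambda-X^{s_i\lambda}}{1-X^{-\alpha_i}}$. $\widetilde{H}_{\{i\}}$ is the subalgebra generated by $T_i$ and $\mathbb{C}[X]$. Weights are elements of $T=\mathrm{Hom}(X,\mathbb{C}^\times)$, with $W_0$-action $(wt)(X^\lambda)=t(X^{w^{-1}\lambda})$; $t_{z,w}\in T$ is given by $t_{z,w}(X^{\alpha_1})=z$, $t_{z,w}(X^{\alpha_2})=w$. *)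

theory Defs
  imports "HOL-Algebra.Algebra" "HOL-Library.Poly_Mapping" "HOL-Library.Product_Plus"
    Complex_Main
begin

section \<open>Left modules over rings\<close>

text \<open>The library's locale \<open>module\<close> requires a commutative base ring; the following is the same
  list of axioms over an arbitrary ring. The library's \<open>submodule\<close> needs no commutativity.\<close>

locale left_module = R?: ring R + M?: abelian_group M
    for R :: "('a, 'm) ring_scheme" (structure) and M :: "('a, 'b, 'n) module_scheme" (structure) +
  assumes smult_closed:
      "\<lbrakk>a \<in> carrier R; x \<in> carrier M\<rbrakk> \<Longrightarrow> a \<odot>\<^bsub>M\<^esub> x \<in> carrier M"
    and smult_l_distr:
      "\<lbrakk>a \<in> carrier R; b \<in> carrier R; x \<in> carrier M\<rbrakk> \<Longrightarrow>
        (a \<oplus>\<^bsub>R\<^esub> b) \<odot>\<^bsub>M\<^esub> x = a \<odot>\<^bsub>M\<^esub> x \<oplus>\<^bsub>M\<^esub> b \<odot>\<^bsub>M\<^esub> x"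
    and smult_r_distr:
      "\<lbrakk>a \<in> carrier R; x \<in> carrier M; y \<in> carrier M\<rbrakk> \<Longrightarrow>
        a \<odot>\<^bsub>M\<^esub> (x \<oplus>\<^bsub>M\<^esub> y) = a \<odot>\<^bsub>M\<^esub> x \<oplus>\<^bsub>M\<^esub> a \<odot>\<^bsub>M\<^esub> y"
    and smult_assoc:
      "\<lbrakk>a \<in> carrier R; b \<in> carrier R; x \<in> carrier M\<rbrakk> \<Longrightarrow>
        (a \<otimes>\<^bsub>R\<^esub> b) \<odot>\<^bsub>M\<^esub> x = a \<odot>\<^bsub>M\<^esub> (b \<odot>\<^bsub>M\<^esub> x)"
    and smult_one:
      "x \<in> carrier M \<Longrightarrow> \<one>\<^bsub>R\<^esub> \<odot>\<^bsub>M\<^esub> x = x"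

definition irreducible_module ::
    "('a, 'm) ring_scheme \<Rightarrow> ('a, 'b, 'n) module_scheme \<Rightarrow> bool" where
  "irreducible_module R M \<longleftrightarrow>
     left_module R M \<and> carrier M \<noteq> {\<zero>\<^bsub>M\<^esub>} \<and>
     (\<forall>N. submodule N R M \<longrightarrow> N = {\<zero>\<^bsub>M\<^esub>} \<or> N = carrier M)"

text \<open>The tensor product \<open>R \<otimes>\<^bsub>S\<^esub> V\<close>, for \<open>S\<close> a subring of \<open>R\<close> acting on \<open>R\<close> by right
  multiplication: the free abelian group on \<open>R \<times> V\<close> modulo the subgroup generated by the
  biadditivity and balancing relations.\<close>

definition tensor_rels ::
    "('a, 'm) ring_scheme \<Rightarrow> ('a, 'k) ring_scheme \<Rightarrow> ('a, 'b, 'n) module_scheme \<Rightarrow> ('a \<times> 'b \<Rightarrow>\<^sub>0 int) set"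
  where
  "tensor_rels R S V =
     {frag_of (r \<oplus>\<^bsub>R\<^esub> r', v) - frag_of (r, v) - frag_of (r', v) | r r' v.
        r \<in> carrier R \<and> r' \<in> carrier R \<and> v \<in> carrier V} \<union>
     {frag_of (r, v \<oplus>\<^bsub>V\<^esub> v') - frag_of (r, v) - frag_of (r, v') | r v v'.
        r \<in> carrier R \<and> v \<in> carrier V \<and> v' \<in> carrier V} \<union>
     {frag_of (r \<otimes>\<^bsub>R\<^esub> s, v) - frag_of (r, s \<odot>\<^bsub>V\<^esub> v) | r s v.
        r \<in> carrier R \<and> s \<in> carrier S \<and> v \<in> carrier V}"

definition tensor_kernel ::
    "('a, 'm) ring_scheme \<Rightarrow> ('a, 'k) ring_scheme \<Rightarrow> ('a, 'b, 'n) module_scheme \<Rightarrow> ('a \<times> 'b \<Rightarrow>\<^sub>0 int) set"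
  where
  "tensor_kernel R S V =
     generate (free_Abelian_group (carrier R \<times> carrier V)) (tensor_rels R S V)"

definition tensor_group ::
    "('a, 'm) ring_scheme \<Rightarrow> ('a, 'k) ring_scheme \<Rightarrow> ('a, 'b, 'n) module_scheme \<Rightarrow>
      ('a \<times> 'b \<Rightarrow>\<^sub>0 int) set monoid"
  where
  "tensor_group R S V =
     free_Abelian_group (carrier R \<times> carrier V) Mod tensor_kernel R S V"

text \<open>The scalar \<open>a\<close> acts by \<open>a \<cdot> (r \<otimes> v) = (a r) \<otimes> v\<close>, extended additively; the union below
  is over the cosets of the representatives of \<open>C\<close>, which all coincide. The fields \<open>mult\<close> and
  \<open>one\<close> of a module record carry no meaning.\<close>

definition induced_module ::
    "('a, 'm) ring_scheme \<Rightarrow> ('a, 'k) ring_scheme \<Rightarrow> ('a, 'b, 'n) module_scheme \<Rightarrow>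
      ('a, ('a \<times> 'b \<Rightarrow>\<^sub>0 int) set) module"
  where
  "induced_module R S V =
     \<lparr>carrier = carrier (tensor_group R S V),
      monoid.mult = (\<lambda>_ _. undefined),
      one = undefined,
      ring.zero = \<one>\<^bsub>tensor_group R S V\<^esub>,
      add = monoid.mult (tensor_group R S V),
      smult = (\<lambda>a C. \<Union>c\<in>C. tensor_kernel R S V #>\<^bsub>free_Abelian_group (carrier R \<times> carrier V)\<^esub>
                 frag_extend (\<lambda>(r, v). frag_of (a \<otimes>\<^bsub>R\<^esub> r, v)) c)\<rparr>"


section \<open>The root system of type \<open>G\<^sub>2\<close> and weights\<close>

datatype node = N1 | N2

text \<open>\<open>(a, b)\<close> stands for \<open>a \<alpha>\<^sub>1 + b \<alpha>\<^sub>2\<close>.\<close>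

type_synonym root_lattice = "int \<times> int"

fun simple_root :: "node \<Rightarrow> root_lattice" where
  "simple_root N1 = (1, 0)"
| "simple_root N2 = (0, 1)"

text \<open>\<open>cartan i j\<close> is \<open>\<langle>\<alpha>\<^sub>i, \<alpha>\<^sub>j\<^sup>\<or>\<rangle>\<close>.\<close>

fun cartan :: "node \<Rightarrow> node \<Rightarrow> int" where
  "cartan N1 N1 = 2"
| "cartan N1 N2 = -1"
| "cartan N2 N1 = -3"
| "cartan N2 N2 = 2"

definition coroot_pairing :: "root_lattice \<Rightarrow> node \<Rightarrow> int" where
  "coroot_pairing l i = fst l * cartan N1 i + snd l * cartan N2 i"

definition lat_scale :: "int \<Rightarrow> root_lattice \<Rightarrow> root_lattice" where
  "lat_scale k l = (k * fst l, k * snd l)"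

definition simple_refl :: "node \<Rightarrow> root_lattice \<Rightarrow> root_lattice" where
  "simple_refl i l = l - lat_scale (coroot_pairing l i) (simple_root i)"

definition weyl_w0 :: "root_lattice \<Rightarrow> root_lattice" where
  "weyl_w0 = simple_refl N1 \<circ> simple_refl N2 \<circ> simple_refl N1 \<circ> simple_refl N2 \<circ> simple_refl N1 \<circ> simple_refl N2"

text \<open>A weight \<open>t \<in> Hom(X, \<complex>\<^sup>\<times>)\<close> is the function \<open>\<lambda> \<mapsto> t(X\<^sup>\<lambda>)\<close>.\<close>

definition weights :: "(root_lattice \<Rightarrow> complex) set" where
  "weights = {t. (\<forall>l m. t (l + m) = t l * t m) \<and> (\<forall>l. t l \<noteq> 0)}"

definition weyl_act :: "(root_lattice \<Rightarrow> root_lattice) \<Rightarrow> (root_lattice \<Rightarrow> complex) \<Rightarrow> root_lattice \<Rightarrow> complex" where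
  "weyl_act w t = (\<lambda>l. t (inv_into UNIV w l))"

definition weight_of :: "complex \<Rightarrow> complex \<Rightarrow> root_lattice \<Rightarrow> complex" where
  "weight_of z w = (\<lambda>(a, b). z powi a * w powi b)"

lemma weight_of_simple_root [simp]:
  "weight_of z w (simple_root N1) = z" "weight_of z w (simple_root N2) = w"
  by (simp_all add: weight_of_def)

lemma weight_of_in_weights:
  assumes "z \<noteq> 0" "w \<noteq> 0"
  shows "weight_of z w \<in> weights"
  using assms by (auto simp: weights_def weight_of_def power_int_add)

lemma simple_refl_N1: "simple_refl N1 (a, b) = (3 * b - a, b)"
  and simple_refl_N2: "simple_refl N2 (a, b) = (a, a - b)"
  by (simp_all add: simple_refl_def lat_scale_def coroot_pairing_def algebra_simps)

lemma simple_refl_simple_refl [simp]: "simple_refl i (simple_refl i l) = l"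
  by (cases i; cases l) (simp_all add: simple_refl_N1 simple_refl_N2)

lemma bij_simple_refl: "bij (simple_refl i)"
  by (rule o_bij[where g = "simple_refl i"]) auto

lemma inv_simple_refl [simp]: "inv_into UNIV (simple_refl i) = simple_refl i"
  by (rule inv_unique_comp) auto

lemma weyl_w0_eq: "weyl_w0 l = - l"
  by (cases l) (simp add: weyl_w0_def simple_refl_N1 simple_refl_N2)

lemma weyl_act_s2_s1:
  assumes "t = weyl_act (simple_refl N2 \<circ> simple_refl N1) (weight_of z 1)"
  shows "t (simple_root N1) = z ^ 2" "t (simple_root N2) = z powi (-3)"
  using assms
  by (simp_all add: weyl_act_def o_inv_distrib bij_simple_refl simple_refl_N1 simple_refl_N2 weight_of_def)


section \<open>The affine Hecke algebra\<close>

datatype generator = GenT node | GenX root_lattice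

text \<open>Words in the generators form a monoid under concatenation, written additively so that the
  library's convolution product on \<open>word \<Rightarrow>\<^sub>0 complex\<close> is the product of the free algebra.\<close>

datatype word = Word (letters: "generator list")

instantiation word :: monoid_add
begin

definition zero_word :: word where "zero_word = Word []"

definition plus_word :: "word \<Rightarrow> word \<Rightarrow> word" where
  "plus_word u v = Word (letters u @ letters v)"

instance
  by standard (simp_all add: zero_word_def plus_word_def)

end

type_synonym free_alg = "word \<Rightarrow>\<^sub>0 complex"
type_synonym group_alg = "root_lattice \<Rightarrow>\<^sub>0 complex"

definition gen :: "generator \<Rightarrow> free_alg" where
  "gen g = Poly_Mapping.single (Word [g]) 1"

definition const :: "complex \<Rightarrow> free_alg" where
  "const c = Poly_Mapping.single 0 c"

definition Xpow :: "root_lattice \<Rightarrow> group_alg" where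
  "Xpow l = Poly_Mapping.single l 1"

definition of_group_alg :: "group_alg \<Rightarrow> free_alg" where
  "of_group_alg f = (\<Sum>l\<in>Poly_Mapping.keys f. const (Poly_Mapping.lookup f l) * gen (GenX l))"

text \<open>\<open>f\<close> is the fraction \<open>(X\<^sup>\<lambda> - X\<^bsup>s\<^sub>i \<lambda>\<^esup>) / (1 - X\<^bsup>-\<alpha>\<^sub>i\<^esup>)\<close> in \<open>\<complex>[X]\<close>.\<close>

definition is_bernstein_quotient :: "node \<Rightarrow> root_lattice \<Rightarrow> group_alg \<Rightarrow> bool" where
  "is_bernstein_quotient i l f \<longleftrightarrow> f * (1 - Xpow (- simple_root i)) = Xpow l - Xpow (simple_refl i l)"

lemma Xpow_add: "Xpow (l + m) = Xpow l * Xpow m"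
  by (simp add: Xpow_def Poly_Mapping.mult_single)

lemma Xpow_zero: "Xpow 0 = 1"
  by (simp add: Xpow_def)

lemma telescope:
  "(\<Sum>k<n. Xpow (l - lat_scale (int k) a)) * (1 - Xpow (- a)) = Xpow l - Xpow (l - lat_scale (int n) a)"
proof (induction n)
  case 0
  have "lat_scale 0 a = 0" by (simp add: lat_scale_def zero_prod_def)
  then show ?case by simp
next
  case (Suc n)
  have "l - lat_scale (int (Suc n)) a = (l - lat_scale (int n) a) + (- a)"
    by (cases l; cases a) (simp add: lat_scale_def algebra_simps)
  then have "Xpow (l - lat_scale (int (Suc n)) a) = Xpow (l - lat_scale (int n) a) * Xpow (- a)"
    by (simp only: Xpow_add)
  then show ?case
    by (simp only: sum.lessThan_Suc distrib_right Suc.IH) (simp add: right_diff_distrib)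
qed

lemma bernstein_quotient_exists: "\<exists>f. is_bernstein_quotient i l f"
proof (cases "coroot_pairing l i \<ge> 0")
  case True
  then show ?thesis
    using telescope[of l "simple_root i" "nat (coroot_pairing l i)"]
    by (auto simp: is_bernstein_quotient_def simple_refl_def)
next
  case False
  let ?n = "nat (- coroot_pairing l i)"
  have "simple_refl i l - lat_scale (int ?n) (simple_root i) = l"
    using False by (cases l) (simp add: simple_refl_def lat_scale_def algebra_simps)
  then have "(- (\<Sum>k<?n. Xpow (simple_refl i l - lat_scale (int k) (simple_root i))))
      * (1 - Xpow (- simple_root i)) = Xpow l - Xpow (simple_refl i l)"
    using telescope[of "simple_refl i l" "simple_root i" ?n] by simp
  then show ?thesis unfolding is_bernstein_quotient_def by blast
qed

lemma bernstein_quotient_unique: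
  assumes "is_bernstein_quotient i l f" "is_bernstein_quotient i l g"
  shows "f = g"
proof (rule ccontr)
  assume "f \<noteq> g"
  define h where "h = f - g"
  let ?a = "simple_root i"
  let ?K = "Poly_Mapping.keys h"
  have "h * (1 - Xpow (- ?a)) = 0"
    using assms by (simp add: h_def is_bernstein_quotient_def left_diff_distrib)
  then have "h - h * Xpow (- ?a) = 0"
    by (simp only: right_diff_distrib mult_1_right)
  then have h: "h = h * Xpow (- ?a)"
    by (rule right_minus_eq[THEN iffD1])
  have step: "k + ?a \<in> ?K" if "k \<in> ?K" for k
  proof -
    have "k \<in> Poly_Mapping.keys (h * Xpow (- ?a))" using that by (subst (asm) h)
    then have "k \<in> {m + n | m n. m \<in> ?K \<and> n \<in> Poly_Mapping.keys (Xpow (- ?a))}"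
      using keys_mult[of h "Xpow (- ?a)"] by (rule set_rev_mp)
    then have "\<exists>m n. k = m + n \<and> m \<in> ?K \<and> n \<in> Poly_Mapping.keys (Xpow (- ?a))"
      by (rule CollectD)
    then obtain m n where "k = m + n" "m \<in> ?K" "n \<in> Poly_Mapping.keys (Xpow (- ?a))"
      by (elim exE conjE)
    moreover from this(3) have "n = - ?a"
      by (simp add: Xpow_def split: if_splits)
    ultimately show ?thesis by simp
  qed
  have "?K \<noteq> {}" using \<open>f \<noteq> g\<close> by (simp add: h_def)
  then obtain k where "k \<in> ?K" by blast
  define \<phi> where "\<phi> = (\<lambda>m :: root_lattice. fst m + snd m)"
  have \<phi>: "\<phi> (m + ?a) = \<phi> m + 1" for m by (cases i) (simp_all add: \<phi>_def)
  have fin: "finite (\<phi> ` ?K)" by simp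
  have "Max (\<phi> ` ?K) \<in> \<phi> ` ?K"
    by (rule Max_in[OF fin]) (use \<open>k \<in> ?K\<close> in blast)
  then obtain m where m: "Max (\<phi> ` ?K) = \<phi> m" "m \<in> ?K" by (rule imageE)
  have "\<phi> (m + ?a) \<le> Max (\<phi> ` ?K)"
    using step[OF m(2)] by (intro Max_ge[OF fin] imageI)
  with m(1) \<phi>[of m] show False by linarith
qed

definition hecke_rels :: "complex \<Rightarrow> free_alg set" where
  "hecke_rels q =
     {gen (GenX 0) - 1} \<union>
     {gen (GenX l) * gen (GenX m) - gen (GenX (l + m)) | l m. True} \<union>
     {gen (GenT i) * gen (GenT i) - (const (q - inverse q) * gen (GenT i) + 1) | i. True} \<union>
     {gen (GenT N1) * gen (GenT N2) * gen (GenT N1) * gen (GenT N2) * gen (GenT N1) * gen (GenT N2)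
      - gen (GenT N2) * gen (GenT N1) * gen (GenT N2) * gen (GenT N1) * gen (GenT N2) * gen (GenT N1)} \<union>
     {gen (GenX l) * gen (GenT i)
      - (gen (GenT i) * gen (GenX (simple_refl i l)) + const (q - inverse q) * of_group_alg f) | i l f.
        is_bernstein_quotient i l f}"

definition free_ring :: "free_alg ring" where
  "free_ring = \<lparr>carrier = UNIV, monoid.mult = (*), one = 1, ring.zero = 0, add = (+)\<rparr>"

definition hecke_ideal :: "complex \<Rightarrow> free_alg set" where
  "hecke_ideal q = genideal free_ring (hecke_rels q)"

definition affine_hecke :: "complex \<Rightarrow> free_alg set ring" where
  "affine_hecke q = FactRing free_ring (hecke_ideal q)"

definition hecke_class :: "complex \<Rightarrow> free_alg \<Rightarrow> free_alg set" where
  "hecke_class q a = a_r_coset free_ring (hecke_ideal q) a"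

abbreviation Hscal :: "complex \<Rightarrow> complex \<Rightarrow> free_alg set" where
  "Hscal q c \<equiv> hecke_class q (const c)"

abbreviation HT :: "complex \<Rightarrow> node \<Rightarrow> free_alg set" where
  "HT q i \<equiv> hecke_class q (gen (GenT i))"

abbreviation HX :: "complex \<Rightarrow> root_lattice \<Rightarrow> free_alg set" where
  "HX q l \<equiv> hecke_class q (gen (GenX l))"

text \<open>The subalgebra generated by \<open>T\<^sub>i\<close> and the image of \<open>\<complex>[X]\<close>; the latter contains the scalars.\<close>

definition hecke_sub :: "complex \<Rightarrow> node \<Rightarrow> free_alg set ring" where
  "hecke_sub q i = (affine_hecke q)
     \<lparr>carrier := generate_ring (affine_hecke q)
        (insert (HT q i) (range (\<lambda>f. hecke_class q (of_group_alg f))))\<rparr>"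

lemma ring_free_ring: "ring free_ring"
proof -
  have "\<exists>y. x + y = 0" "\<exists>y. y + x = 0" for x :: free_alg
    by (rule exI[of _ "- x"], simp)+
  then show ?thesis
    by unfold_locales (auto simp: free_ring_def algebra_simps Units_def)
qed

lemma ideal_hecke_ideal: "ideal (hecke_ideal q) free_ring"
  unfolding hecke_ideal_def
  by (rule ring.genideal_ideal[OF ring_free_ring]) (simp add: free_ring_def)

lemma ring_affine_hecke: "ring (affine_hecke q)"
  unfolding affine_hecke_def by (rule ideal.quotient_is_ring[OF ideal_hecke_ideal])

text \<open>\<open>V\<close> is the one-dimensional module \<open>\<complex>v\<close> over the subalgebra generated by \<open>T\<^sub>i\<close> and \<open>\<complex>[X]\<close>,
  with \<open>T\<^sub>i v = c v\<close> and \<open>X\<^sup>\<lambda> v = t(X\<^sup>\<lambda>) v\<close>.\<close>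

definition is_weight_line ::
    "complex \<Rightarrow> node \<Rightarrow> complex \<Rightarrow> (root_lattice \<Rightarrow> complex) \<Rightarrow> (free_alg set, 'v) module \<Rightarrow> 'v \<Rightarrow> bool"
  where
  "is_weight_line q i c t V v \<longleftrightarrow>
     left_module (hecke_sub q i) V \<and>
     v \<in> carrier V \<and> v \<noteq> \<zero>\<^bsub>V\<^esub> \<and> carrier V = range (\<lambda>z. Hscal q z \<odot>\<^bsub>V\<^esub> v) \<and>
     HT q i \<odot>\<^bsub>V\<^esub> v = Hscal q c \<odot>\<^bsub>V\<^esub> v \<and>
     (\<forall>l. HX q l \<odot>\<^bsub>V\<^esub> v = Hscal q (t l) \<odot>\<^bsub>V\<^esub> v)"

end

theory Submission
  imports Defs
begin

text \<open>Two reductions carry the proof.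

The relations of the Hecke algebra involve \<open>q\<close> only through \<open>q - q\<inverse>\<close>, so they do not change
when \<open>q\<close> is replaced by \<open>-q\<inverse>\<close>. Under this replacement, together with \<open>\<epsilon> \<mapsto> -\<epsilon>\<close>, the data of \<open>M\<close>
become those of \<open>N\<close>: the eigenvalue of \<open>T\<^sub>1\<close> becomes \<open>-q\<inverse>\<close>, and \<open>z = \<epsilon>q\<close> becomes \<open>z\<inverse>\<close>, so that
\<open>t\<close>, given by \<open>t(X\<^sup>\<lambda>) = z\<^bsup>2a-3b\<^esup>\<close> for \<open>\<lambda> = a\<alpha>\<^sub>1 + b\<alpha>\<^sub>2\<close>, becomes \<open>t\<inverse> = w\<^sub>0t\<close>. It is enough to treat \<open>M\<close>.

The module \<open>M\<close> is generated by \<open>1 \<otimes> v\<close> and spanned over \<open>\<complex>\<close> by the six tensors \<open>T\<^sub>w \<otimes> v\<close>, where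
\<open>w = 1, s\<^sub>2, s\<^sub>1s\<^sub>2, s\<^sub>2s\<^sub>1s\<^sub>2, \<dots>\<close> runs through the minimal representatives of the cosets of \<open>\<langle>s\<^sub>1\<rangle>\<close>: the
braid relation turns \<open>T\<^sub>1T\<^sub>2T\<^sub>1T\<^sub>2T\<^sub>1T\<^sub>2\<close> into a word that ends in \<open>T\<^sub>1\<close>, and the Bernstein relation
moves every \<open>X\<^sup>\<lambda>\<close> to \<open>v\<close> (\<open>spanned_all\<close>). That the six tensors are independent, and in particular that
\<open>M\<close> is nonzero, is seen from an explicit representation on \<open>\<complex>\<^sup>6\<close> in which a vector \<open>e\<^sub>0\<close> spans a line
isomorphic to \<open>\<complex>v\<close> and the six \<open>T\<^sub>w e\<^sub>0\<close> are the unit vectors up to sign. Hence \<open>a \<otimes> v \<mapsto> a e\<^sub>0\<close> is an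
isomorphism (\<open>tens_eq_zero_iff\<close>), and the claim becomes one about \<open>6\<times>6\<close> matrices.

The matrices of \<open>T\<^sub>1\<close> and \<open>T\<^sub>2\<close> are immediate. Those of all \<open>X\<^sup>\<lambda>\<close> come from the single matrix \<open>Y\<close> of
\<open>X\<^bsup>2\<alpha>\<^sub>1+\<alpha>\<^sub>2\<^esup>\<close>, because \<open>s\<^sub>2\<close> fixes \<open>2\<alpha>\<^sub>1+\<alpha>\<^sub>2\<close>, \<open>s\<^sub>1\<close> exchanges it with \<open>\<alpha>\<^sub>1+\<alpha>\<^sub>2\<close>, and these two weights form
a basis of the lattice. The weights that satisfy the Bernstein relation form a subgroup, so this
relation has to be checked on the basis only (\<open>bernstein_relation\<close>).

For the irreducibility let \<open>x\<close> be a nonzero vector of \<open>\<complex>\<^sup>6\<close>. A suitable word in \<open>T\<^sub>1\<close> and \<open>T\<^sub>2\<close> moves its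
last nonzero coordinate to the last place (\<open>raise_to_top\<close>). The weights of \<open>M\<close> are \<open>t'\<close>, \<open>s\<^sub>1t'\<close> and \<open>t\<close>,
each with multiplicity two, and a product of three factors in \<open>X\<^bsup>2\<alpha>\<^sub>1+\<alpha>\<^sub>2\<^esup>\<close> and \<open>X\<^bsup>\<alpha>\<^sub>1+\<alpha>\<^sub>2\<^esup>\<close> kills the first
two generalized weight spaces and maps the third onto \<open>\<complex>e\<^sub>0\<close>. It is \<open>c\<close> times the matrix unit that sends
the last unit vector to \<open>e\<^sub>0\<close>, where \<open>c = z\<inverse>(1-z)(1-z\<^sup>2)(1-z\<^sup>5)\<close> (\<open>socle_op_explicit\<close>). The factors
are nonzero because \<open>z\<^sup>2 = q\<^sup>2 \<noteq> 1\<close> and \<open>z\<^sup>3 = t'(X\<^bsup>3\<alpha>\<^sub>1\<^esup>) \<noteq> q\<^bsup>-2\<^esup>\<close>. So \<open>x\<close> generates \<open>e\<^sub>0\<close>, and with it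
everything.\<close>

section \<open>Modules induced from a cyclic module\<close>

text \<open>If \<open>V\<close> is generated over \<open>S\<close> by one vector \<open>v\<close>, every element of \<open>R \<otimes>\<^bsub>S\<^esub> V\<close> is a pure tensor \<open>r \<otimes> v\<close>,
so that the induced module is a quotient of \<open>R\<close> by a left ideal and questions about it become
questions about elements of \<open>R\<close>.\<close>

locale cyclic_induction = ring R
  for R :: "('a, 'm) ring_scheme" (structure) +
  fixes S :: "('a, 'k) ring_scheme" and V :: "('a, 'b, 'n) module_scheme" and v :: 'b
  assumes sub: "carrier S \<subseteq> carrier R"
    and V_module: "left_module S V"
    and v_closed: "v \<in> carrier V"
    and v_cyclic: "x \<in> carrier V \<Longrightarrow> \<exists>s\<in>carrier S. x = s \<odot>\<^bsub>V\<^esub> v"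
begin

abbreviation "F \<equiv> free_Abelian_group (carrier R \<times> carrier V)"
abbreviation "K \<equiv> tensor_kernel R S V"
abbreviation "M \<equiv> induced_module R S V"

definition lact :: "'a \<Rightarrow> ('a \<times> 'b \<Rightarrow>\<^sub>0 int) \<Rightarrow> ('a \<times> 'b \<Rightarrow>\<^sub>0 int)" where
  "lact a = frag_extend (\<lambda>(r, x). frag_of (a \<otimes> r, x))"

definition tclass :: "('a \<times> 'b \<Rightarrow>\<^sub>0 int) \<Rightarrow> ('a \<times> 'b \<Rightarrow>\<^sub>0 int) set" where
  "tclass c = K #>\<^bsub>F\<^esub> c"

definition pure :: "'a \<Rightarrow> ('a \<times> 'b \<Rightarrow>\<^sub>0 int) set" where
  "pure r = tclass (frag_of (r, v))"

lemma V_add: "x \<in> carrier V \<Longrightarrow> y \<in> carrier V \<Longrightarrow> x \<oplus>\<^bsub>V\<^esub> y \<in> carrier V"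
  by (rule abelian_monoid.a_closed[OF abelian_group.axioms(1)[OF left_module.axioms(2)[OF V_module]]])

lemma V_smult: "s \<in> carrier S \<Longrightarrow> x \<in> carrier V \<Longrightarrow> s \<odot>\<^bsub>V\<^esub> x \<in> carrier V"
  by (rule left_module.smult_closed[OF V_module])

lemma F_diff: "c \<in> carrier F \<Longrightarrow> d \<in> carrier F \<Longrightarrow> c - d \<in> carrier F"
  unfolding carrier_free_Abelian_group_iff using keys_diff[of c d] by blast

lemma F_of: "r \<in> carrier R \<Longrightarrow> x \<in> carrier V \<Longrightarrow> frag_of (r, x) \<in> carrier F"
  by simp

lemma rels_carrier: "tensor_rels R S V \<subseteq> carrier F"
  unfolding tensor_rels_def using sub
  by (auto intro!: F_diff F_of V_add V_smult simp del: carrier_free_Abelian_group_iff)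

lemma K_subgroup: "subgroup K F"
  unfolding tensor_kernel_def
  by (rule group.generate_is_subgroup[OF group_free_Abelian_group rels_carrier])

lemma K_normal: "K \<lhd> F"
  by (rule comm_group.subgroup_imp_normal[OF abelian_free_Abelian_group K_subgroup])

lemma K_keys: "c \<in> K \<Longrightarrow> Poly_Mapping.keys c \<subseteq> carrier R \<times> carrier V"
  using subgroup.mem_carrier[OF K_subgroup] by simp

lemma K_zero: "0 \<in> K"
  using subgroup.one_closed[OF K_subgroup] by simp

lemma K_add: "c \<in> K \<Longrightarrow> d \<in> K \<Longrightarrow> c + d \<in> K"
  using subgroup.m_closed[OF K_subgroup, of c d] by simp

lemma K_uminus: "c \<in> K \<Longrightarrow> - c \<in> K"
  using subgroup.m_inv_closed[OF K_subgroup, of c] K_keys by simp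

lemma K_diff: "c \<in> K \<Longrightarrow> d \<in> K \<Longrightarrow> c - d \<in> K"
  using K_add[OF _ K_uminus, of c d] by simp

lemma K_rel: "c \<in> tensor_rels R S V \<Longrightarrow> c \<in> K"
  unfolding tensor_kernel_def by (rule generate.incl)

lemma K_induct [consumes 1, case_names rel zero diff]:
  assumes "c \<in> K"
    and "\<And>c. c \<in> tensor_rels R S V \<Longrightarrow> P c"
    and "P 0"
    and "\<And>c d. P c \<Longrightarrow> P d \<Longrightarrow> P (c - d)"
  shows "P c"
  using assms(1) unfolding tensor_kernel_def
proof (induction rule: generate.induct)
  case one then show ?case using assms(3) by simp
next
  case (incl h) then show ?case by (rule assms(2))
next
  case (inv h)
  then have "inv\<^bsub>F\<^esub> h = 0 - h" using rels_carrier by auto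
  then show ?case using assms(4)[OF assms(3) assms(2)[OF inv]] by simp
next
  case (eng c d)
  have "P (c - (0 - d))" by (intro assms(3,4) eng.IH)
  then show ?case by simp
qed

lemma tclass_mem: "d \<in> tclass c \<longleftrightarrow> d - c \<in> K"
  unfolding tclass_def r_coset_def by (auto simp: diff_add_eq intro: bexI[of _ "d - c"])

lemma tclass_eq: "tclass c = tclass d \<longleftrightarrow> c - d \<in> K"
proof
  assume "tclass c = tclass d"
  then have "c \<in> tclass d" using tclass_mem[of c c] K_zero by simp
  then show "c - d \<in> K" by (simp add: tclass_mem)
next
  assume *: "c - d \<in> K"
  have "e - c \<in> K \<longleftrightarrow> e - d \<in> K" for e
    using K_add[OF _ *, of "e - c"] K_diff[OF _ *, of "e - d"] by auto
  then show "tclass c = tclass d" by (auto simp: tclass_mem)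
qed

lemma carrier_M: "carrier M = tclass ` carrier F"
  by (auto simp: induced_module_def tensor_group_def carrier_FactGroup tclass_def)

lemma zero_M: "\<zero>\<^bsub>M\<^esub> = tclass 0"
proof -
  have "\<zero>\<^bsub>M\<^esub> = K" by (simp add: induced_module_def tensor_group_def)
  also have "K = tclass 0" by (auto simp: tclass_mem)
  finally show ?thesis .
qed

lemma add_M:
  assumes "c \<in> carrier F" "d \<in> carrier F"
  shows "tclass c \<oplus>\<^bsub>M\<^esub> tclass d = tclass (c + d)"
  using normal.rcos_sum[OF K_normal assms]
  by (simp add: induced_module_def tensor_group_def tclass_def)

lemma abelian_group_M: "abelian_group M"
proof (rule abelian_groupI)
  interpret F: comm_group F by (rule abelian_free_Abelian_group)
  have add: "c + d \<in> carrier F" if "c \<in> carrier F" "d \<in> carrier F" for c d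
    using F.m_closed[OF that] by simp
  have zero: "0 \<in> carrier F" by simp
  show "\<zero>\<^bsub>M\<^esub> \<in> carrier M" unfolding zero_M carrier_M using zero by (rule imageI)
  fix x assume "x \<in> carrier M"
  then obtain c where c: "x = tclass c" "c \<in> carrier F" unfolding carrier_M by (rule imageE)
  show "\<zero>\<^bsub>M\<^esub> \<oplus>\<^bsub>M\<^esub> x = x" unfolding zero_M c(1) add_M[OF zero c(2)] by simp
  have "- c \<in> carrier F" using F_diff[OF zero c(2)] by simp
  moreover have "tclass (- c) \<oplus>\<^bsub>M\<^esub> x = \<zero>\<^bsub>M\<^esub>"
    unfolding c(1) add_M[OF calculation c(2)] zero_M by simp
  ultimately show "\<exists>y\<in>carrier M. y \<oplus>\<^bsub>M\<^esub> x = \<zero>\<^bsub>M\<^esub>" unfolding carrier_M by blast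
  fix y assume "y \<in> carrier M"
  then obtain d where d: "y = tclass d" "d \<in> carrier F" unfolding carrier_M by (rule imageE)
  show "x \<oplus>\<^bsub>M\<^esub> y \<in> carrier M"
    unfolding c(1) d(1) add_M[OF c(2) d(2)] carrier_M using add[OF c(2) d(2)] by (rule imageI)
  show "x \<oplus>\<^bsub>M\<^esub> y = y \<oplus>\<^bsub>M\<^esub> x"
    unfolding c(1) d(1) add_M[OF c(2) d(2)] add_M[OF d(2) c(2)] by (simp add: add.commute)
  fix z assume "z \<in> carrier M"
  then obtain e where e: "z = tclass e" "e \<in> carrier F" unfolding carrier_M by (rule imageE)
  show "x \<oplus>\<^bsub>M\<^esub> y \<oplus>\<^bsub>M\<^esub> z = x \<oplus>\<^bsub>M\<^esub> (y \<oplus>\<^bsub>M\<^esub> z)"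
    unfolding c(1) d(1) e(1)
    by (simp only: add_M c(2) d(2) e(2) add add.assoc)
qed

lemma lact_diff: "lact a (c - d) = lact a c - lact a d"
  and lact_zero: "lact a 0 = 0"
  and lact_of: "lact a (frag_of (r, x)) = frag_of (a \<otimes> r, x)"
  by (simp_all add: lact_def frag_extend_diff)

lemma lact_K:
  assumes a: "a \<in> carrier R" and c: "c \<in> K"
  shows "lact a c \<in> K"
  using c
proof (induction rule: K_induct)
  case (rel c)
  then have "lact a c \<in> tensor_rels R S V"
    unfolding tensor_rels_def
  proof (elim UnE, goal_cases)
    case 1
    then obtain r r' x where "c = frag_of (r \<oplus> r', x) - frag_of (r, x) - frag_of (r', x)"
      "r \<in> carrier R" "r' \<in> carrier R" "x \<in> carrier V" by blast
    then show ?case using a by (auto simp: lact_diff lact_of r_distr)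
  next
    case 2
    then obtain r x x' where "c = frag_of (r, x \<oplus>\<^bsub>V\<^esub> x') - frag_of (r, x) - frag_of (r, x')"
      "r \<in> carrier R" "x \<in> carrier V" "x' \<in> carrier V" by blast
    then show ?case using a by (auto simp: lact_diff lact_of)
  next
    case 3
    then obtain r s x where "c = frag_of (r \<otimes> s, x) - frag_of (r, s \<odot>\<^bsub>V\<^esub> x)"
      "r \<in> carrier R" "s \<in> carrier S" "x \<in> carrier V" by blast
    moreover from this have "lact a c = frag_of ((a \<otimes> r) \<otimes> s, x) - frag_of (a \<otimes> r, s \<odot>\<^bsub>V\<^esub> x)"
      using a sub by (auto simp: lact_diff lact_of m_assoc)
    ultimately show ?case using a by blast
  qed
  then show ?case by (rule K_rel)
qed (simp_all add: lact_zero lact_diff K_zero K_diff)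

text \<open>The representatives of a coset are all sent into one coset, because the action preserves the kernel;
so the union that defines the scalar multiplication has a single value.\<close>

lemma smult_M:
  assumes a: "a \<in> carrier R"
  shows "a \<odot>\<^bsub>M\<^esub> tclass c = tclass (lact a c)"
proof -
  have "a \<odot>\<^bsub>M\<^esub> tclass c = (\<Union>d\<in>tclass c. tclass (lact a d))"
    by (simp add: induced_module_def tclass_def lact_def)
  also have "\<dots> = (\<Union>d\<in>tclass c. tclass (lact a c))"
    by (intro SUP_cong refl)
      (auto simp: tclass_eq tclass_mem lact_K[OF a] simp flip: lact_diff)
  also have "\<dots> = tclass (lact a c)"
    using tclass_mem[of c c] K_zero by auto
  finally show ?thesis .
qed

lemma frag_pure_carrier: "r \<in> carrier R \<Longrightarrow> frag_of (r, v) \<in> carrier F"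
  using v_closed by simp

lemma pure_closed: "r \<in> carrier R \<Longrightarrow> pure r \<in> carrier M"
  using v_closed by (auto simp: carrier_M pure_def)

lemma pure_add:
  assumes "r \<in> carrier R" "s \<in> carrier R"
  shows "pure (r \<oplus> s) = pure r \<oplus>\<^bsub>M\<^esub> pure s"
proof -
  have "frag_of (r \<oplus> s, v) - frag_of (r, v) - frag_of (s, v) \<in> K"
    by (rule K_rel) (use assms v_closed in \<open>unfold tensor_rels_def, blast\<close>)
  then have "pure (r \<oplus> s) = tclass (frag_of (r, v) + frag_of (s, v))"
    by (simp add: pure_def tclass_eq diff_diff_eq)
  then show ?thesis using assms by (simp add: pure_def add_M frag_pure_carrier v_closed)
qed

lemma pure_smult:
  assumes "a \<in> carrier R"
  shows "a \<odot>\<^bsub>M\<^esub> pure r = pure (a \<otimes> r)"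
  using assms by (simp add: pure_def smult_M lact_of)

lemma pure_zero: "pure \<zero> = \<zero>\<^bsub>M\<^esub>"
proof -
  interpret M: abelian_group M by (rule abelian_group_M)
  have "pure \<zero> \<oplus>\<^bsub>M\<^esub> pure \<zero> = pure \<zero>"
    using pure_add[of \<zero> \<zero>] by simp
  then show ?thesis
    using pure_closed[of \<zero>] M.add.l_cancel_one by (metis zero_closed)
qed

lemma pure_balance:
  assumes "r \<in> carrier R" "s \<in> carrier S"
  shows "tclass (frag_of (r, s \<odot>\<^bsub>V\<^esub> v)) = pure (r \<otimes> s)"
proof -
  have "frag_of (r \<otimes> s, v) - frag_of (r, s \<odot>\<^bsub>V\<^esub> v) \<in> K"
    by (rule K_rel) (use assms v_closed in \<open>unfold tensor_rels_def, blast\<close>)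
  then show ?thesis using tclass_eq pure_def by metis
qed

text \<open>A generator \<open>r \<otimes> s v\<close> equals \<open>r s \<otimes> v\<close>, and tensors with the same second factor \<open>v\<close> add in the first.\<close>

lemma carrier_M_pure: "carrier M = pure ` carrier R"
proof
  interpret M: abelian_group M by (rule abelian_group_M)
  have "tclass c \<in> pure ` carrier R" if "Poly_Mapping.keys c \<subseteq> carrier R \<times> carrier V" for c
    using that
  proof (rule free_Abelian_group_induct)
    show "tclass 0 \<in> pure ` carrier R" using pure_zero zero_M by (metis imageI zero_closed)
  next
    fix x y
    assume 2: "Poly_Mapping.keys x \<subseteq> carrier R \<times> carrier V" "Poly_Mapping.keys y \<subseteq> carrier R \<times> carrier V"
      "tclass x \<in> pure ` carrier R" "tclass y \<in> pure ` carrier R"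
    then obtain r s where rs: "r \<in> carrier R" "s \<in> carrier R" "tclass x = pure r" "tclass y = pure s"
      by blast
    have "tclass (x - y) \<oplus>\<^bsub>M\<^esub> tclass y = tclass x"
      using 2(1,2) F_diff[of x y] 2(1,2) by (simp add: add_M)
    moreover have "pure (r \<ominus> s) \<oplus>\<^bsub>M\<^esub> pure s = pure r"
      using rs(1,2) by (simp flip: pure_add add: minus_eq a_assoc l_neg)
    moreover have "tclass (x - y) \<in> carrier M"
      using F_diff[of x y] 2(1,2) by (auto simp: carrier_M)
    ultimately have "tclass (x - y) = pure (r \<ominus> s)"
      using rs pure_closed by (metis M.add.r_cancel minus_closed)
    then show "tclass (x - y) \<in> pure ` carrier R" using rs by blast
  next
    fix a assume "a \<in> carrier R \<times> carrier V"
    then obtain r x where a: "a = (r, x)" "r \<in> carrier R" "x \<in> carrier V" by blast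
    then obtain s where s: "s \<in> carrier S" "x = s \<odot>\<^bsub>V\<^esub> v" using v_cyclic by blast
    then have "tclass (frag_of a) = pure (r \<otimes> s)" using a pure_balance by simp
    then show "tclass (frag_of a) \<in> pure ` carrier R" using a s sub by blast
  qed
  then show "carrier M \<subseteq> pure ` carrier R"
    by (auto simp: carrier_M)
  show "pure ` carrier R \<subseteq> carrier M" using pure_closed by blast
qed

lemma left_module_M: "left_module R M"
proof (intro left_module.intro left_module_axioms.intro)
  show "Ring.ring R" by (rule ring_axioms)
  show "abelian_group M" by (rule abelian_group_M)
  show "a \<odot>\<^bsub>M\<^esub> x \<in> carrier M" if "a \<in> carrier R" "x \<in> carrier M" for a x
    using that by (auto simp: carrier_M_pure pure_smult)
  show "(a \<oplus> b) \<odot>\<^bsub>M\<^esub> x = a \<odot>\<^bsub>M\<^esub> x \<oplus>\<^bsub>M\<^esub> b \<odot>\<^bsub>M\<^esub> x"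
    if "a \<in> carrier R" "b \<in> carrier R" "x \<in> carrier M" for a b x
    using that by (auto simp: carrier_M_pure pure_smult l_distr simp flip: pure_add)
  show "a \<odot>\<^bsub>M\<^esub> (x \<oplus>\<^bsub>M\<^esub> y) = a \<odot>\<^bsub>M\<^esub> x \<oplus>\<^bsub>M\<^esub> a \<odot>\<^bsub>M\<^esub> y"
    if "a \<in> carrier R" "x \<in> carrier M" "y \<in> carrier M" for a x y
    using that by (auto simp: carrier_M_pure pure_smult r_distr simp flip: pure_add)
  show "(a \<otimes> b) \<odot>\<^bsub>M\<^esub> x = a \<odot>\<^bsub>M\<^esub> (b \<odot>\<^bsub>M\<^esub> x)"
    if "a \<in> carrier R" "b \<in> carrier R" "x \<in> carrier M" for a b x
    using that by (auto simp: carrier_M_pure pure_smult m_assoc)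
  show "\<one> \<odot>\<^bsub>M\<^esub> x = x" if "x \<in> carrier M" for x
    using that by (auto simp: carrier_M_pure pure_smult)
qed

text \<open>Under the second assumption a nonzero submodule contains \<open>1 \<otimes> v\<close>, which generates everything.\<close>

lemma irreducibleI:
  assumes "pure \<one> \<noteq> \<zero>\<^bsub>M\<^esub>"
    and gen: "\<And>r. r \<in> carrier R \<Longrightarrow> pure r \<noteq> \<zero>\<^bsub>M\<^esub> \<Longrightarrow> \<exists>b\<in>carrier R. pure (b \<otimes> r) = pure \<one>"
  shows "irreducible_module R M"
  unfolding irreducible_module_def
proof (intro conjI allI impI)
  show "left_module R M" by (rule left_module_M)
  show "carrier M \<noteq> {\<zero>\<^bsub>M\<^esub>}" using assms(1) pure_closed by blast
  fix N assume N: "submodule N R M"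
  then interpret N: submodule N R M .
  show "N = {\<zero>\<^bsub>M\<^esub>} \<or> N = carrier M"
  proof (cases "N \<subseteq> {\<zero>\<^bsub>M\<^esub>}")
    case True
    then show ?thesis using N.one_closed by auto
  next
    case False
    then obtain x where x: "x \<in> N" "x \<noteq> \<zero>\<^bsub>M\<^esub>" by blast
    then have "x \<in> carrier M" using N.mem_carrier by simp
    then obtain r where r: "r \<in> carrier R" "x = pure r" unfolding carrier_M_pure by blast
    then obtain b where b: "b \<in> carrier R" "pure (b \<otimes> r) = pure \<one>" using gen x by blast
    have one: "pure \<one> \<in> N"
      using N.smult_closed[OF b(1) x(1)] pure_smult[OF b(1), of r] r b by simp
    have "pure s \<in> N" if "s \<in> carrier R" for s
      using N.smult_closed[OF that one] pure_smult[OF that, of \<one>] that by simp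
    then show ?thesis using N.subset unfolding carrier_M_pure by auto
  qed
qed

text \<open>A nonzero value of a balanced biadditive functional detects a tensor: the additive extension of the
functional to the free abelian group vanishes on the defining relations, hence on the kernel.\<close>

lemma pure_nonzeroI:
  fixes \<phi> :: "'a \<Rightarrow> 'b \<Rightarrow> complex"
  assumes l: "\<And>r r' x. r \<in> carrier R \<Longrightarrow> r' \<in> carrier R \<Longrightarrow> x \<in> carrier V \<Longrightarrow>
        \<phi> (r \<oplus> r') x = \<phi> r x + \<phi> r' x"
    and r: "\<And>r x x'. r \<in> carrier R \<Longrightarrow> x \<in> carrier V \<Longrightarrow> x' \<in> carrier V \<Longrightarrow>
        \<phi> r (x \<oplus>\<^bsub>V\<^esub> x') = \<phi> r x + \<phi> r x'"
    and b: "\<And>r s x. r \<in> carrier R \<Longrightarrow> s \<in> carrier S \<Longrightarrow> x \<in> carrier V \<Longrightarrow>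
        \<phi> (r \<otimes> s) x = \<phi> r (s \<odot>\<^bsub>V\<^esub> x)"
    and nz: "\<phi> a v \<noteq> 0"
  shows "pure a \<noteq> \<zero>\<^bsub>M\<^esub>"
proof
  define h where
    "h c = (\<Sum>k\<in>Poly_Mapping.keys c. of_int (Poly_Mapping.lookup c k) * \<phi> (fst k) (snd k))"
    for c :: "'a \<times> 'b \<Rightarrow>\<^sub>0 int"
  have h_add: "h (c + d) = h c + h d" for c d
    unfolding h_def by (rule setsum_keys_plus_distrib) (simp_all add: distrib_right)
  have h_of: "h (frag_of (s, x)) = \<phi> s x" for s x
    by (simp add: h_def)
  have h_diff: "h (c - d) = h c - h d" for c d
    using h_add[of "c - d" d] by simp
  have "h c = 0" if "c \<in> K" for c
    using that
  proof (induction rule: K_induct)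
    case (rel c)
    then show ?case
      unfolding tensor_rels_def
      by (elim UnE CollectE exE conjE) (simp_all add: h_diff h_of l r b)
  qed (simp_all add: h_diff, simp add: h_def)
  moreover assume "pure a = \<zero>\<^bsub>M\<^esub>"
  then have "frag_of (a, v) \<in> K"
    by (simp add: pure_def zero_M tclass_eq)
  ultimately show False using h_of nz by metis
qed

end

section \<open>Linear operators on a six-dimensional space\<close>

type_synonym vec6 = "complex \<times> complex \<times> complex \<times> complex \<times> complex \<times> complex"

definition vscale :: "complex \<Rightarrow> vec6 \<Rightarrow> vec6" where
  "vscale c = (\<lambda>(x0, x1, x2, x3, x4, x5). (c * x0, c * x1, c * x2, c * x3, c * x4, c * x5))"

lemma vscale_add: "vscale c (x + y) = vscale c x + vscale c y"
  and vscale_add_left: "vscale (c + d) x = vscale c x + vscale d x"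
  and vscale_vscale: "vscale c (vscale d x) = vscale (c * d) x"
  and vscale_one: "vscale 1 x = x"
  and vscale_zero_left: "vscale 0 x = 0"
  and vscale_zero: "vscale c 0 = 0"
  and vscale_minus_left: "vscale (- c) x = - vscale c x"
  and vscale_minus: "vscale c (- x) = - vscale c x"
  and vscale_diff: "vscale c (x - y) = vscale c x - vscale c y"
  by (cases x; cases y; simp add: vscale_def algebra_simps zero_prod_def)+

definition linear_op :: "(vec6 \<Rightarrow> vec6) \<Rightarrow> bool" where
  "linear_op f \<longleftrightarrow> (\<forall>x y. f (x + y) = f x + f y) \<and> (\<forall>c x. f (vscale c x) = vscale c (f x))"

lemma linear_op_add: "linear_op f \<Longrightarrow> f (x + y) = f x + f y"
  and linear_op_scale: "linear_op f \<Longrightarrow> f (vscale c x) = vscale c (f x)"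
  unfolding linear_op_def by blast+

lemma linear_opI:
  "(\<And>x y. f (x + y) = f x + f y) \<Longrightarrow> (\<And>c x. f (vscale c x) = vscale c (f x)) \<Longrightarrow> linear_op f"
  unfolding linear_op_def by blast

lemma linear_op_zero: "linear_op f \<Longrightarrow> f 0 = 0"
  using linear_op_scale[of f 0 0] by (simp add: vscale_zero_left)

lemma linear_op_minus: "linear_op f \<Longrightarrow> f (- x) = - f x"
  using linear_op_scale[of f "-1" x] by (simp add: vscale_minus_left vscale_one)

lemma linear_op_diff: "linear_op f \<Longrightarrow> f (x - y) = f x - f y"
  using linear_op_add[of f x "- y"] by (simp add: linear_op_minus)

lemma linear_op_sum: "linear_op f \<Longrightarrow> f (sum g A) = (\<Sum>a\<in>A. f (g a))"
  by (induction A rule: infinite_finite_induct) (simp_all add: linear_op_zero linear_op_add)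

lemma linear_op_comp: "linear_op f \<Longrightarrow> linear_op g \<Longrightarrow> linear_op (f \<circ> g)"
  by (rule linear_opI) (simp_all add: linear_op_add linear_op_scale)

lemma linear_op_id: "linear_op id"
  by (rule linear_opI) simp_all

lemma linear_op_shift: "linear_op f \<Longrightarrow> linear_op (\<lambda>x. f x - vscale c x)"
  by (rule linear_opI)
    (simp_all add: linear_op_add linear_op_scale vscale_add vscale_diff vscale_vscale mult.commute)

lemma linear_op_funpow: "linear_op f \<Longrightarrow> linear_op (f ^^ n)"
  by (induction n) (simp_all add: linear_op_comp linear_op_id)

section \<open>Integer powers of a bijection\<close>

definition ipow :: "('a \<Rightarrow> 'a) \<Rightarrow> ('a \<Rightarrow> 'a) \<Rightarrow> int \<Rightarrow> 'a \<Rightarrow> 'a" where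
  "ipow f g k = (if k \<ge> 0 then f ^^ nat k else g ^^ nat (- k))"

lemma ipow_simps: "ipow f g 0 = id" "ipow f g 1 = f" "ipow f g (-1) = g"
  by (simp_all add: ipow_def)

lemma linear_op_ipow: "linear_op f \<Longrightarrow> linear_op g \<Longrightarrow> linear_op (ipow f g k)"
  by (simp add: ipow_def linear_op_funpow)

locale inverse_pair =
  fixes f g :: "'a \<Rightarrow> 'a"
  assumes fg: "f (g x) = x" and gf: "g (f x) = x"
begin

lemma ipow_succ: "ipow f g (k + 1) x = f (ipow f g k x)"
proof (cases "k \<ge> 0")
  case True
  then have "nat (k + 1) = Suc (nat k)" by simp
  then show ?thesis using True by (simp add: ipow_def)
next
  case False
  then have "nat (- k) = Suc (nat (- (k + 1)))" by simp
  then have "ipow f g k x = g (ipow f g (k + 1) x)"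
    using False by (cases "k + 1 = 0") (simp_all add: ipow_def)
  then show ?thesis by (simp add: fg)
qed

lemma ipow_pred: "ipow f g (k - 1) x = g (ipow f g k x)"
  using ipow_succ[of "k - 1" x] by (simp add: gf)

lemma ipow_add: "ipow f g (j + k) x = ipow f g j (ipow f g k x)"
proof (induction j rule: int_induct[of _ 0])
  case base
  then show ?case by (simp add: ipow_simps)
next
  case (step1 i)
  have "i + 1 + k = (i + k) + 1" by simp
  then show ?case using step1 by (simp only: ipow_succ)
next
  case (step2 i)
  have "i - 1 + k = (i + k) - 1" by simp
  then show ?case using step2 by (simp only: ipow_pred)
qed

lemma ipow_commute:
  assumes "\<And>x. h (f x) = f (h x)"
  shows "h (ipow f g k x) = ipow f g k (h x)"
proof (induction k rule: int_induct[of _ 0])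
  case base
  then show ?case by (simp add: ipow_simps)
next
  case (step1 i)
  then show ?case by (simp add: ipow_succ assms)
next
  case (step2 i)
  have "h (g y) = g (h y)" for y
    by (metis assms fg gf)
  then show ?case using step2 by (simp add: ipow_pred)
qed

end

section \<open>Linear combinations\<close>

lemma poly_mapping_additive_induct [case_names zero single add]:
  fixes f :: "'a \<Rightarrow>\<^sub>0 'b::monoid_add"
  assumes "P 0" "\<And>k c. P (Poly_Mapping.single k c)" "\<And>f g. P f \<Longrightarrow> P g \<Longrightarrow> P (f + g)"
  shows "P f"
proof (induction f rule: Poly_Mapping.update_induct)
  case const
  then show ?case by (rule assms(1))
next
  case (update f a b)
  have "Poly_Mapping.update a b f = Poly_Mapping.single a b + f"
    using update(1)
    by (intro poly_mapping_eqI)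
      (auto simp: Poly_Mapping.lookup_update lookup_add lookup_single in_keys_iff when_def)
  then show ?case using assms(2,3) update by simp
qed

definition lincomb :: "('k \<Rightarrow>\<^sub>0 complex) \<Rightarrow> ('k \<Rightarrow> vec6) \<Rightarrow> vec6" where
  "lincomb f h = (\<Sum>k\<in>Poly_Mapping.keys f. vscale (Poly_Mapping.lookup f k) (h k))"

lemma lincomb_add: "lincomb (f + g) h = lincomb f h + lincomb g h"
  unfolding lincomb_def by (rule setsum_keys_plus_distrib) (simp_all add: vscale_zero_left vscale_add_left)

lemma lincomb_zero: "lincomb 0 h = 0"
  by (simp add: lincomb_def)

lemma lincomb_single: "lincomb (Poly_Mapping.single k c) h = vscale c (h k)"
  by (simp add: lincomb_def vscale_zero_left)

lemma lincomb_minus: "lincomb (- f) h = - lincomb f h"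
  using lincomb_add[of f "- f" h] by (simp add: lincomb_zero eq_neg_iff_add_eq_0 add.commute)

lemma lincomb_diff: "lincomb (f - g) h = lincomb f h - lincomb g h"
  using lincomb_add[of f "- g" h] by (simp add: lincomb_minus)

lemma lincomb_linear_op: "linear_op F \<Longrightarrow> F (lincomb f h) = lincomb f (\<lambda>k. F (h k))"
  by (simp add: lincomb_def linear_op_sum linear_op_scale)

lemma lincomb_add_right: "lincomb f (\<lambda>k. g k + h k) = lincomb f g + lincomb f h"
  by (simp add: lincomb_def vscale_add sum.distrib)

lemma lincomb_scale_right: "lincomb f (\<lambda>k. vscale c (h k)) = vscale c (lincomb f h)"
  by (rule lincomb_linear_op[symmetric]) (rule linear_opI, simp_all add: vscale_add vscale_vscale mult.commute)

section \<open>Representations of the free algebra\<close>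

locale word_action =
  fixes act :: "generator \<Rightarrow> vec6 \<Rightarrow> vec6"
  assumes linear_act: "linear_op (act g)"
begin

fun wact :: "generator list \<Rightarrow> vec6 \<Rightarrow> vec6" where
  "wact [] x = x"
| "wact (g # gs) x = act g (wact gs x)"

definition rep :: "free_alg \<Rightarrow> vec6 \<Rightarrow> vec6" where
  "rep a x = lincomb a (\<lambda>w. wact (letters w) x)"

lemma wact_append: "wact (gs @ hs) x = wact gs (wact hs x)"
  by (induction gs) simp_all

lemma linear_wact: "linear_op (wact gs)"
  by (induction gs)
    (simp_all add: linear_opI linear_op_comp[OF linear_act, unfolded comp_def])

lemma linear_rep: "linear_op (rep a)"
  by (rule linear_opI)
    (simp_all add: rep_def linear_op_add[OF linear_wact] linear_op_scale[OF linear_wact]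
      lincomb_add_right lincomb_scale_right)

lemma rep_add: "rep (a + b) x = rep a x + rep b x"
  and rep_diff: "rep (a - b) x = rep a x - rep b x"
  and rep_zero: "rep 0 x = 0"
  by (simp_all add: rep_def lincomb_add lincomb_diff lincomb_zero)

lemma rep_sum: "rep (sum f A) x = (\<Sum>a\<in>A. rep (f a) x)"
  by (induction A rule: infinite_finite_induct) (simp_all add: rep_zero rep_add)

lemma rep_const: "rep (const c) x = vscale c x"
  by (simp add: rep_def const_def lincomb_single zero_word_def)

lemma rep_one: "rep 1 x = x"
  using rep_const[of 1 x] by (simp add: const_def vscale_one)

lemma rep_gen: "rep (gen g) x = act g x"
  by (simp add: rep_def gen_def lincomb_single vscale_one)

lemma rep_mult: "rep (a * b) x = rep a (rep b x)"
proof (induction a rule: poly_mapping_additive_induct)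
  case (single v c)
  show ?case
  proof (induction b rule: poly_mapping_additive_induct)
    case (single w d)
    show ?case
      by (simp add: mult_single rep_def lincomb_single plus_word_def wact_append
          linear_op_scale[OF linear_wact] vscale_vscale)
  qed (simp_all add: rep_zero rep_add distrib_left linear_op_zero[OF linear_rep] linear_op_add[OF linear_rep])
qed (simp_all add: rep_zero rep_add distrib_right)

lemma rep_of_group_alg: "rep (of_group_alg f) x = lincomb f (\<lambda>l. act (GenX l) x)"
  by (simp add: of_group_alg_def rep_sum rep_mult rep_const rep_gen lincomb_def)

end

section \<open>Six-dimensional operators for \<open>T\<^sub>1\<close>, \<open>T\<^sub>2\<close> and \<open>X\<^sup>\<lambda>\<close>\<close>

text \<open>The vectors \<open>(x\<^sub>0, \<dots>, x\<^sub>5)\<close> are coordinates with respect to \<open>v, T\<^sub>2v, T\<^sub>1T\<^sub>2v, \<dots>, T\<^sub>2T\<^sub>1T\<^sub>2T\<^sub>1T\<^sub>2v\<close> in a module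
where \<open>T\<^sub>1v = zv\<close>, and the operators below are the matrices of \<open>T\<^sub>1\<close>, \<open>T\<^sub>2\<close> and of \<open>Y = X\<^bsup>2\<alpha>\<^sub>1+\<alpha>\<^sub>2\<^esup>\<close> on this
basis. The entries of \<open>Y\<close> result from moving \<open>X\<^bsup>2\<alpha>\<^sub>1+\<alpha>\<^sub>2\<^esup>\<close> to \<open>v\<close> by the Bernstein relation.

The parameter is \<open>z = \<epsilon>q\<close> in place of \<open>q\<close>. Since \<open>\<epsilon>\<^sup>2 = 1\<close>, the elements \<open>\<epsilon>T\<^sub>i\<close> satisfy the relations for
\<open>z\<close>, and the weight \<open>t\<close> depends on \<open>z\<close> only; this removes the sign from the matrices.\<close>

locale g2_operators =
  fixes z :: complex
  assumes z0: "z \<noteq> 0"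
begin

abbreviation \<kappa> :: complex where "\<kappa> \<equiv> z - inverse z"

definition T1 :: "vec6 \<Rightarrow> vec6" where
  "T1 = (\<lambda>(x0, x1, x2, x3, x4, x5). (z * x0, x2, x1 + \<kappa> * x2, x4, x3 + \<kappa> * x4, z * x5))"

definition T2 :: "vec6 \<Rightarrow> vec6" where
  "T2 = (\<lambda>(x0, x1, x2, x3, x4, x5). (x1, x0 + \<kappa> * x1, x3, x2 + \<kappa> * x3, x5, x4 + \<kappa> * x5))"

definition Y :: "vec6 \<Rightarrow> vec6" where
  "Y = (\<lambda>(x0, x1, x2, x3, x4, x5).
     (z * x0 + \<kappa> * x2 + z * \<kappa> * x3 + z * \<kappa> * (1 + z) * x4 + z ^ 3 * \<kappa> * x5,
      z * x1 + z * \<kappa> * x2 + z ^ 2 * \<kappa> * x3 + z ^ 3 * \<kappa> * x4 + z * \<kappa> * (1 + z ^ 3) * x5,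
      z ^ 2 * x2 + z * \<kappa> * x4 + z ^ 2 * \<kappa> * x5,
      z ^ 2 * x3 + z ^ 2 * \<kappa> * x4 + z ^ 3 * \<kappa> * x5,
      z * x4,
      z * x5))"

definition Y_inv :: "vec6 \<Rightarrow> vec6" where
  "Y_inv = (\<lambda>(x0, x1, x2, x3, x4, x5). let p = inverse z in
     (p * x0 - p ^ 3 * \<kappa> * x2 - p ^ 2 * \<kappa> * x3 - p * \<kappa> * (1 + p ^ 3) * x4 - p ^ 3 * \<kappa> * x5,
      p * x1 - p ^ 2 * \<kappa> * x2 - p * \<kappa> * x3 - p ^ 3 * \<kappa> * x4 - p * \<kappa> * (1 + p) * x5,
      p ^ 2 * x2 - p ^ 2 * \<kappa> * x4 - p * \<kappa> * x5,
      p ^ 2 * x3 - p * \<kappa> * x4 - \<kappa> * x5,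
      p * x4,
      p * x5))"

definition T1_inv :: "vec6 \<Rightarrow> vec6" where "T1_inv x = T1 x - vscale \<kappa> x"
definition T2_inv :: "vec6 \<Rightarrow> vec6" where "T2_inv x = T2 x - vscale \<kappa> x"

text \<open>The operator of \<open>X\<^bsup>\<alpha>\<^sub>1+\<alpha>\<^sub>2\<^esup>\<close>. The weight \<open>\<lambda> = 2\<alpha>\<^sub>1+\<alpha>\<^sub>2\<close> has pairing \<open>1\<close> with \<open>\<alpha>\<^sub>1\<^sup>\<or>\<close>, and for such \<open>\<lambda>\<close> the
Bernstein relation reads \<open>X\<^bsup>s\<^sub>1\<lambda>\<^esup> = T\<^sub>1\<inverse> X\<^sup>\<lambda> T\<^sub>1\<inverse>\<close>.\<close>

definition Z :: "vec6 \<Rightarrow> vec6" where "Z x = T1_inv (Y (T1_inv x))"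
definition Z_inv :: "vec6 \<Rightarrow> vec6" where "Z_inv x = T1 (Y_inv (T1 x))"

lemma linear_T1: "linear_op T1" and linear_T2: "linear_op T2"
  and linear_Y: "linear_op Y" and linear_Y_inv: "linear_op Y_inv"
  by (auto simp: linear_op_def T1_def T2_def Y_def Y_inv_def vscale_def Let_def algebra_simps)

lemma linear_T1_inv: "linear_op T1_inv" and linear_T2_inv: "linear_op T2_inv"
  using linear_op_shift[OF linear_T1, of \<kappa>] linear_op_shift[OF linear_T2, of \<kappa>]
  by (simp_all flip: T1_inv_def T2_inv_def)

lemma linear_Z: "linear_op Z" and linear_Z_inv: "linear_op Z_inv"
  using linear_op_comp[OF linear_op_comp[OF linear_T1_inv linear_Y] linear_T1_inv]
    linear_op_comp[OF linear_op_comp[OF linear_T1 linear_Y_inv] linear_T1]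
  by (simp_all add: comp_def flip: Z_def Z_inv_def)

lemma T1_square: "T1 (T1 x) = vscale \<kappa> (T1 x) + x"
  and T2_square: "T2 (T2 x) = vscale \<kappa> (T2 x) + x"
  using z0 by (cases x; simp add: T1_def T2_def vscale_def field_simps)+

lemma T1_inverse: "T1 (T1_inv x) = x" "T1_inv (T1 x) = x"
  and T2_inverse: "T2 (T2_inv x) = x" "T2_inv (T2 x) = x"
  by (simp_all add: T1_inv_def T2_inv_def linear_op_diff[OF linear_T1] linear_op_diff[OF linear_T2]
      linear_op_scale[OF linear_T1] linear_op_scale[OF linear_T2] T1_square T2_square)

lemma braid: "T1 (T2 (T1 (T2 (T1 (T2 x))))) = T2 (T1 (T2 (T1 (T2 (T1 x)))))"
  using z0 by (cases x; simp add: T1_def T2_def field_simps)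

lemma Y_inverse: "Y (Y_inv x) = x" "Y_inv (Y x) = x"
  using z0 by (cases x; simp add: Y_def Y_inv_def Let_def field_simps power2_eq_square power3_eq_cube)+

lemma Y_T2: "Y (T2 x) = T2 (Y x)"
  using z0 by (cases x; simp add: Y_def T2_def field_simps power2_eq_square power3_eq_cube)

lemma Z_inverse: "Z (Z_inv x) = x" "Z_inv (Z x) = x"
  by (simp_all add: Z_def Z_inv_def T1_inverse Y_inverse)

definition unit_vec :: "nat \<Rightarrow> vec6" where
  "unit_vec i = (of_bool (i = 0), of_bool (i = 1), of_bool (i = 2), of_bool (i = 3), of_bool (i = 4), of_bool (i = 5))"

lemma linear_op_eq:
  assumes "linear_op f" "linear_op g" "\<And>i. i < 6 \<Longrightarrow> f (unit_vec i) = g (unit_vec i)"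
  shows "f x = g x"
proof -
  have expand: "x = (\<Sum>i<6. vscale ([fst x, fst (snd x), fst (snd (snd x)), fst (snd (snd (snd x))),
      fst (snd (snd (snd (snd x)))), snd (snd (snd (snd (snd x))))] ! i) (unit_vec i))" (is "x = sum ?e _")
    by (cases x) (simp add: eval_nat_numeral vscale_def unit_vec_def zero_prod_def)
  have "f x = (\<Sum>i<6. f (?e i))" by (subst expand) (rule linear_op_sum[OF assms(1)])
  also have "\<dots> = (\<Sum>i<6. g (?e i))"
    by (intro sum.cong refl) (simp add: linear_op_scale assms)
  also have "\<dots> = g x" by (subst (2) expand) (rule linear_op_sum[OF assms(2), symmetric])
  finally show ?thesis .
qed

lemma less_6: "i < 6 \<longleftrightarrow> i = 0 \<or> i = 1 \<or> i = 2 \<or> i = 3 \<or> i = 4 \<or> i = (5::nat)"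
  by auto

text \<open>The composition that defines \<open>Z\<close>, multiplied out. Products that involve \<open>Z\<close> are computed on unit vectors
from these coordinates, which keeps the rational functions small.\<close>

definition Z_matrix :: "vec6 \<Rightarrow> vec6" where
  "Z_matrix = (\<lambda>(x0, x1, x2, x3, x4, x5).
     (inverse z * x0 + inverse z * \<kappa> * x1 + inverse z * \<kappa> * (1 + z) * x3 + \<kappa> * x4 + z * \<kappa> * x5,
      z ^ 2 * x1 - z * \<kappa> * x2 + z * \<kappa> * (1 - \<kappa>) * x3 - z ^ 2 * \<kappa> ^ 2 * x4 + \<kappa> * (inverse z - z ^ 3 * \<kappa>) * x5,
      z * x2 + z * \<kappa> * x3 + z ^ 2 * \<kappa> * x4 + \<kappa> * (1 + z ^ 3) * x5,
      z * x3 - z ^ 2 * \<kappa> * x4 - z ^ 2 * \<kappa> ^ 2 * x5,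
      z ^ 2 * x4 + z ^ 2 * \<kappa> * x5,
      inverse z * x5))"

lemma linear_Z_matrix: "linear_op Z_matrix"
  by (rule linear_opI) (auto simp: Z_matrix_def vscale_def algebra_simps)

lemma Z_eq_matrix: "Z x = Z_matrix x"
proof (rule linear_op_eq[OF linear_Z linear_Z_matrix])
  fix i :: nat assume "i < 6"
  then show "Z (unit_vec i) = Z_matrix (unit_vec i)"
    unfolding less_6 using z0
    by (elim disjE; simp add: unit_vec_def zero_prod_def Z_def T1_inv_def T1_def Y_def Z_matrix_def vscale_def;
        simp add: field_simps eval_nat_numeral)
qed

text \<open>The counterpart of the definition of \<open>Z\<close> for \<open>s\<^sub>2\<close>, which exchanges \<open>\<alpha>\<^sub>1+\<alpha>\<^sub>2\<close> and
\<open>\<alpha>\<^sub>1 = (2\<alpha>\<^sub>1+\<alpha>\<^sub>2) - (\<alpha>\<^sub>1+\<alpha>\<^sub>2)\<close>: the operator \<open>T\<^sub>2\<inverse> Z T\<^sub>2\<inverse>\<close> is \<open>Y Z\<inverse>\<close>.\<close>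

lemma Z_matrix_T2_inv_Z_matrix: "Z_matrix (T2_inv (Z_matrix x)) = T2 (Y x)"
proof (rule linear_op_eq[where f = "Z_matrix \<circ> T2_inv \<circ> Z_matrix" and g = "T2 \<circ> Y", unfolded comp_def])
  fix i :: nat assume "i < 6"
  then show "Z_matrix (T2_inv (Z_matrix (unit_vec i))) = T2 (Y (unit_vec i))"
    unfolding less_6 using z0
    by (elim disjE; simp add: unit_vec_def zero_prod_def Z_matrix_def T2_inv_def T2_def Y_def vscale_def;
        simp add: field_simps eval_nat_numeral)
qed (use linear_op_comp[OF linear_op_comp[OF linear_Z_matrix linear_T2_inv] linear_Z_matrix] linear_op_comp[OF linear_T2 linear_Y]
    in \<open>simp_all add: comp_def\<close>)

lemma Y_Z_matrix: "Y (Z_matrix x) = Z_matrix (Y x)"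
proof (rule linear_op_eq[where f = "Y \<circ> Z_matrix" and g = "Z_matrix \<circ> Y", unfolded comp_def])
  fix i :: nat assume "i < 6"
  then show "Y (Z_matrix (unit_vec i)) = Z_matrix (Y (unit_vec i))"
    unfolding less_6 using z0
    by (elim disjE; simp add: unit_vec_def zero_prod_def Z_matrix_def Y_def;
        simp add: field_simps eval_nat_numeral)
qed (use linear_op_comp[OF linear_Z_matrix linear_Y] linear_op_comp[OF linear_Y linear_Z_matrix]
    in \<open>simp_all add: comp_def\<close>)

text \<open>The product \<open>(Y - z\<^sup>2)(Y - z)(Z - z\<^sup>2)\<close>. Suppose that \<open>z\<^sup>2\<close>, \<open>z\<^sup>3\<close> and \<open>z\<^sup>5\<close> differ from \<open>1\<close>. Then \<open>Y\<close> is
the scalar \<open>z\<^sup>2\<close> on the generalized weight space of \<open>t'\<close>, and \<open>Z\<close> is the scalar \<open>z\<^sup>2\<close> on that of \<open>s\<^sub>1t'\<close>. On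
that of \<open>t\<close> the factors with \<open>z\<^sup>2\<close> are invertible, while \<open>Y - z\<close> is nilpotent of rank one and has the line of
\<open>v\<close> as its image.\<close>

definition socle_op :: "vec6 \<Rightarrow> vec6" where
  "socle_op x = (let y = Z x - vscale (z ^ 2) x; w = Y y - vscale z y in Y w - vscale (z ^ 2) w)"

lemma linear_socle_op: "linear_op socle_op"
  using linear_op_comp[OF linear_op_comp[OF linear_op_shift[OF linear_Y] linear_op_shift[OF linear_Y]]
      linear_op_shift[OF linear_Z], of "z ^ 2" z "z ^ 2"]
  by (simp add: comp_def socle_op_def[abs_def] Let_def)

lemma socle_op_explicit:
  "socle_op x = vscale (inverse z * (1 - z) * (1 - z ^ 2) * (1 - z ^ 5) * snd (snd (snd (snd (snd x))))) (unit_vec 0)"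
proof (rule linear_op_eq[OF linear_socle_op])
  fix i :: nat assume "i < 6"
  then show "socle_op (unit_vec i) =
      vscale (inverse z * (1 - z) * (1 - z ^ 2) * (1 - z ^ 5) * snd (snd (snd (snd (snd (unit_vec i)))))) (unit_vec 0)"
    unfolding less_6 using z0
    by (elim disjE; simp add: socle_op_def Let_def Z_eq_matrix unit_vec_def zero_prod_def Z_matrix_def Y_def vscale_def;
        simp add: field_simps eval_nat_numeral)
qed (rule linear_opI, auto simp: vscale_def unit_vec_def algebra_simps)

sublocale Yp: inverse_pair Y Y_inv by unfold_locales (rule Y_inverse)+
sublocale Zp: inverse_pair Z Z_inv by unfold_locales (rule Z_inverse)+

text \<open>The weight \<open>a\<alpha>\<^sub>1 + b\<alpha>\<^sub>2\<close> is \<open>(a - b)(2\<alpha>\<^sub>1+\<alpha>\<^sub>2) + (2b - a)(\<alpha>\<^sub>1+\<alpha>\<^sub>2)\<close>.\<close>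

definition Xop :: "root_lattice \<Rightarrow> vec6 \<Rightarrow> vec6" where
  "Xop l x = ipow Y Y_inv (fst l - snd l) (ipow Z Z_inv (2 * snd l - fst l) x)"

lemma T2_inv_Z_T2_inv_Z: "T2_inv (Z (T2_inv (Z x))) = Y x"
  using Z_matrix_T2_inv_Z_matrix[of x] by (simp add: Z_eq_matrix T2_inverse)

lemma Y_Z: "Y (Z x) = Z (Y x)"
  by (simp add: Z_eq_matrix Y_Z_matrix)

lemma linear_X: "linear_op (Xop l)"
  using linear_op_comp[OF linear_op_ipow[OF linear_Y linear_Y_inv] linear_op_ipow[OF linear_Z linear_Z_inv]]
  unfolding comp_def Xop_def[abs_def] .

lemma X_zero: "Xop 0 x = x"
  by (simp add: Xop_def ipow_simps)

lemma X_add: "Xop (l + m) x = Xop l (Xop m x)"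
proof -
  have "ipow Z Z_inv j (ipow Y Y_inv k y) = ipow Y Y_inv k (ipow Z Z_inv j y)" for j k y
    by (rule Yp.ipow_commute) (metis Zp.ipow_commute Y_Z)
  moreover have "fst (l + m) - snd (l + m) = (fst l - snd l) + (fst m - snd m)"
    "2 * snd (l + m) - fst (l + m) = (2 * snd l - fst l) + (2 * snd m - fst m)" by simp_all
  ultimately show ?thesis by (simp only: Xop_def Yp.ipow_add Zp.ipow_add)
qed

lemma X_21: "Xop (2, 1) = Y" and X_11: "Xop (1, 1) = Z"
  by (simp_all add: Xop_def ipow_simps fun_eq_iff)

lemma X_10: "Xop (1, 0) x = T2_inv (Z (T2_inv x))"
proof -
  have "Xop (1, 0) x = Y (Z_inv x)" by (simp add: Xop_def ipow_simps)
  also have "\<dots> = T2_inv (Z (T2_inv x))" using T2_inv_Z_T2_inv_Z[of "Z_inv x"] by (simp add: Z_inverse)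
  finally show ?thesis .
qed

fun T :: "node \<Rightarrow> vec6 \<Rightarrow> vec6" where
  "T N1 = T1"
| "T N2 = T2"

lemma linear_T: "linear_op (T i)"
  by (cases i) (simp_all add: linear_T1 linear_T2)

definition Xalg :: "group_alg \<Rightarrow> vec6 \<Rightarrow> vec6" where
  "Xalg f x = lincomb f (\<lambda>l. Xop l x)"

lemma Xalg_Xpow: "Xalg (Xpow l) x = Xop l x"
  by (simp add: Xalg_def Xpow_def lincomb_single vscale_one)

lemma Xalg_simps: "Xalg (f + g) x = Xalg f x + Xalg g x" "Xalg (- f) x = - Xalg f x" "Xalg 0 x = 0"
  by (simp_all add: Xalg_def lincomb_add lincomb_minus lincomb_zero)

lemma linear_Xalg: "linear_op (Xalg f)"
  by (rule linear_opI)
    (simp_all add: Xalg_def linear_op_add[OF linear_X] linear_op_scale[OF linear_X]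
      lincomb_add_right lincomb_scale_right)

lemma Xalg_mult: "Xalg (f * g) x = Xalg f (Xalg g x)"
proof (induction f rule: poly_mapping_additive_induct)
  case (single l c)
  show ?case
  proof (induction g rule: poly_mapping_additive_induct)
    case (single m d)
    show ?case
      by (simp add: mult_single Xalg_def lincomb_single X_add linear_op_scale[OF linear_X] vscale_vscale)
  qed (simp_all add: Xalg_simps distrib_left linear_op_zero[OF linear_Xalg] linear_op_add[OF linear_Xalg])
qed (simp_all add: Xalg_simps distrib_right)

section \<open>The Bernstein relation for the operators\<close>

text \<open>The quotient is unique by \<open>bernstein_quotient_unique\<close>; the existential form lets the closure proofs below
exhibit the quotient of a sum or a negative.\<close>

definition bernstein :: "node \<Rightarrow> root_lattice \<Rightarrow> bool" where
  "bernstein i l \<longleftrightarrow> (\<exists>f. is_bernstein_quotient i l f \<and>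
     (\<forall>x. Xop l (T i x) = T i (Xop (simple_refl i l) x) + vscale \<kappa> (Xalg f x)))"

lemma simple_refl_add: "simple_refl i (l + m) = simple_refl i l + simple_refl i m"
  by (cases i; cases l; cases m) (simp_all add: simple_refl_N1 simple_refl_N2)

lemma simple_refl_minus: "simple_refl i (- l) = - simple_refl i l"
  by (cases i; cases l) (simp_all add: simple_refl_N1 simple_refl_N2)

lemma cross_difference: "c * (a - d) + a * (b - c) = a * b - d * c" for a b c d :: group_alg
  by (simp add: algebra_simps)

text \<open>With \<open>f\<close> and \<open>g\<close> the quotients of \<open>l\<close> and \<open>m\<close>, the quotient of \<open>l + m\<close> is \<open>f X\<^bsup>s m\<^esup> + X\<^sup>l g\<close>, as one sees by
moving first \<open>X\<^sup>m\<close> and then \<open>X\<^sup>l\<close> past \<open>T\<^sub>i\<close>.\<close>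

lemma bernstein_add:
  assumes "bernstein i l" "bernstein i m"
  shows "bernstein i (l + m)"
proof -
  let ?s = "simple_refl i"
  obtain f where f: "is_bernstein_quotient i l f"
      "\<And>x. Xop l (T i x) = T i (Xop (?s l) x) + vscale \<kappa> (Xalg f x)"
    using assms(1) unfolding bernstein_def by blast
  obtain g where g: "is_bernstein_quotient i m g"
      "\<And>x. Xop m (T i x) = T i (Xop (?s m) x) + vscale \<kappa> (Xalg g x)"
    using assms(2) unfolding bernstein_def by blast
  let ?h = "f * Xpow (?s m) + Xpow l * g"
  have "(f * c + b * g) * d = c * (f * d) + b * (g * d)" for b c d :: group_alg
    by (simp add: algebra_simps)
  then have "?h * (1 - Xpow (- simple_root i)) =
      Xpow (?s m) * (f * (1 - Xpow (- simple_root i))) + Xpow l * (g * (1 - Xpow (- simple_root i)))"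
    .
  also have "\<dots> = Xpow (l + m) - Xpow (?s (l + m))"
    unfolding f(1)[unfolded is_bernstein_quotient_def] g(1)[unfolded is_bernstein_quotient_def]
    unfolding simple_refl_add Xpow_add
    by (rule cross_difference)
  finally have "is_bernstein_quotient i (l + m) ?h" unfolding is_bernstein_quotient_def .
  moreover have "Xop (l + m) (T i x) = T i (Xop (?s (l + m)) x) + vscale \<kappa> (Xalg ?h x)" for x
    by (simp add: X_add g f linear_op_add[OF linear_X] linear_op_scale[OF linear_X] Xalg_simps
        Xalg_mult Xalg_Xpow vscale_add simple_refl_add add.assoc)
  ultimately show ?thesis unfolding bernstein_def by blast
qed

lemma X_minus: "Xop (- l) (Xop l x) = x" "Xop l (Xop (- l) x) = x"
  by (simp_all add: X_zero flip: X_add)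

lemma bernstein_minus:
  assumes "bernstein i l"
  shows "bernstein i (- l)"
proof -
  let ?s = "simple_refl i"
  obtain f where f: "is_bernstein_quotient i l f"
      "\<And>x. Xop l (T i x) = T i (Xop (?s l) x) + vscale \<kappa> (Xalg f x)"
    using assms(1) unfolding bernstein_def by blast
  let ?h = "- (Xpow (- l) * f * Xpow (- ?s l))"
  have "- (b * f * c) * d = - (b * c * (f * d))" for b c d :: group_alg
    by (simp add: algebra_simps)
  then have "?h * (1 - Xpow (- simple_root i)) =
      - (Xpow (- l) * Xpow (- ?s l) * (f * (1 - Xpow (- simple_root i))))"
    .
  also have "\<dots> = - (Xpow (- l) * Xpow (- ?s l) * (Xpow l - Xpow (?s l)))"
    using f(1) unfolding is_bernstein_quotient_def by simp
  also have "\<dots> = Xpow (- l) - Xpow (- ?s l)"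
    by (simp add: right_diff_distrib flip: Xpow_add)
  finally have "is_bernstein_quotient i (- l) ?h"
    unfolding is_bernstein_quotient_def simple_refl_minus .
  moreover have "Xop (- l) (T i x) = T i (Xop (?s (- l)) x) + vscale \<kappa> (Xalg ?h x)" for x
  proof -
    have "T i x = Xop l (T i (Xop (- ?s l) x)) - vscale \<kappa> (Xalg f (Xop (- ?s l) x))"
      by (simp add: f X_minus)
    then have "Xop (- l) (T i x) = Xop (- l) (Xop l (T i (Xop (- ?s l) x)) - vscale \<kappa> (Xalg f (Xop (- ?s l) x)))"
      by simp
    then show ?thesis
      by (simp add: linear_op_diff[OF linear_X] linear_op_scale[OF linear_X] X_minus simple_refl_minus
          Xalg_simps Xalg_mult Xalg_Xpow vscale_minus)
  qed
  ultimately show ?thesis unfolding bernstein_def by blast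
qed

lemma bernstein_scale:
  assumes "bernstein i l"
  shows "bernstein i (lat_scale k l)"
proof (induction k rule: int_induct[of _ 0])
  case base
  have "is_bernstein_quotient i 0 0"
    by (cases i) (simp_all add: is_bernstein_quotient_def simple_refl_N1 simple_refl_N2 zero_prod_def)
  moreover have "simple_refl i 0 = 0"
    by (cases i) (simp_all add: simple_refl_N1 simple_refl_N2 zero_prod_def)
  ultimately show ?case
    by (force simp: bernstein_def lat_scale_def X_zero Xalg_simps vscale_zero simp flip: zero_prod_def)
next
  case (step1 j)
  have "lat_scale (j + 1) l = lat_scale j l + l" by (cases l) (simp add: lat_scale_def algebra_simps)
  then show ?case using bernstein_add[OF step1(2) assms] by simp
next
  case (step2 j)
  have "lat_scale (j - 1) l = lat_scale j l + - l" by (cases l) (simp add: lat_scale_def algebra_simps)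
  then show ?case using bernstein_add[OF step2(2) bernstein_minus[OF assms]] by simp
qed

text \<open>The pairings of the two basis weights with the simple coroots are \<open>0\<close>, \<open>1\<close> or \<open>-1\<close>, so each quotient is zero or
plus or minus a single power. The four relations then say that \<open>Y\<close> commutes with \<open>T\<^sub>2\<close>, that
\<open>Z = T\<^sub>1\<inverse> Y T\<^sub>1\<inverse>\<close> (twice) and that \<open>X\<^bsup>\<alpha>\<^sub>1\<^esup> = T\<^sub>2\<inverse> Z T\<^sub>2\<inverse>\<close>.\<close>

lemma bernstein_fundamental: "bernstein i (2, 1)" "bernstein i (1, 1)"
proof -
  have t1: "T1_inv y = T1 y - vscale \<kappa> y" and t2: "T2_inv y = T2 y - vscale \<kappa> y" for y
    by (simp_all add: T1_inv_def T2_inv_def)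
  have "T1 (Z x) = Y (T1_inv x)" for x by (simp add: Z_def T1_inverse)
  then have a: "Y (T1 x) = T1 (Z x) + vscale \<kappa> (Y x)" for x
    by (simp add: t1 linear_op_diff[OF linear_Y] linear_op_scale[OF linear_Y])
  have "Z (T1 x) = T1_inv (Y x)" for x by (simp add: Z_def T1_inverse)
  then have b: "Z (T1 x) = T1 (Y x) + vscale \<kappa> (- Y x)" for x
    by (simp add: t1 vscale_minus)
  have "T2 (Xop (1, 0) x) = Z (T2_inv x)" for x by (simp add: X_10 T2_inverse)
  then have d: "Z (T2 x) = T2 (Xop (1, 0) x) + vscale \<kappa> (Z x)" for x
    by (simp add: t2 linear_op_diff[OF linear_Z] linear_op_scale[OF linear_Z])
  have "bernstein N1 (2, 1)"
    unfolding bernstein_def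
    by (rule exI[of _ "Xpow (2, 1)"])
      (simp add: is_bernstein_quotient_def right_diff_distrib simple_refl_N1 X_21 X_11 a Xalg_Xpow
        flip: Xpow_add)
  moreover have "bernstein N1 (1, 1)"
    unfolding bernstein_def
    by (rule exI[of _ "- Xpow (2, 1)"])
      (simp add: is_bernstein_quotient_def right_diff_distrib simple_refl_N1 X_21 X_11 b Xalg_Xpow
        Xalg_simps flip: Xpow_add)
  moreover have "bernstein N2 (2, 1)"
    unfolding bernstein_def
    by (rule exI[of _ 0])
      (simp add: is_bernstein_quotient_def simple_refl_N2 X_21 Y_T2 Xalg_simps vscale_zero)
  moreover have "bernstein N2 (1, 1)"
    unfolding bernstein_def
    by (rule exI[of _ "Xpow (1, 1)"])
      (simp add: is_bernstein_quotient_def right_diff_distrib simple_refl_N2 X_11 d Xalg_Xpow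
        flip: Xpow_add)
  ultimately show "bernstein i (2, 1)" "bernstein i (1, 1)" by (cases i; simp)+
qed

lemma bernstein_relation:
  assumes "is_bernstein_quotient i l f"
  shows "Xop l (T i x) = T i (Xop (simple_refl i l) x) + vscale \<kappa> (Xalg f x)"
proof -
  have "l = lat_scale (fst l - snd l) (2, 1) + lat_scale (2 * snd l - fst l) (1, 1)"
    by (cases l) (simp add: lat_scale_def)
  then have "bernstein i l"
    using bernstein_add[OF bernstein_scale bernstein_scale, OF bernstein_fundamental] by metis
  then obtain g where "is_bernstein_quotient i l g"
      "Xop l (T i x) = T i (Xop (simple_refl i l) x) + vscale \<kappa> (Xalg g x)"
    unfolding bernstein_def by blast
  then show ?thesis using bernstein_quotient_unique[OF assms] by metis
qed

end

section \<open>The Hecke algebra as a quotient\<close>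

lemma free_ring_simps:
  "carrier free_ring = UNIV" "a \<otimes>\<^bsub>free_ring\<^esub> b = a * b" "\<one>\<^bsub>free_ring\<^esub> = 1"
  "\<zero>\<^bsub>free_ring\<^esub> = 0" "a \<oplus>\<^bsub>free_ring\<^esub> b = a + b"
  by (simp_all add: free_ring_def)

lemma free_ring_uminus: "\<ominus>\<^bsub>free_ring\<^esub> a = - a"
  by (rule abelian_group.minus_equality[OF ring.is_abelian_group[OF ring_free_ring]])
    (simp_all add: free_ring_simps)

lemma free_ring_minus: "a \<ominus>\<^bsub>free_ring\<^esub> b = a - b"
  by (simp add: a_minus_def free_ring_uminus free_ring_simps)

lemma carrier_affine_hecke: "carrier (affine_hecke q) = range (hecke_class q)"
  by (auto simp: affine_hecke_def FactRing_def A_RCOSETS_def' a_r_coset_def r_coset_def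
      hecke_class_def free_ring_simps)

lemma hecke_class_closed [simp]: "hecke_class q a \<in> carrier (affine_hecke q)"
  by (simp add: carrier_affine_hecke)

lemma hecke_class_hom: "hecke_class q \<in> ring_hom free_ring (affine_hecke q)"
  using ideal.rcos_ring_hom[OF ideal_hecke_ideal[of q]]
  by (simp add: affine_hecke_def hecke_class_def[abs_def])

lemma hecke_class_add: "hecke_class q (a + b) = hecke_class q a \<oplus>\<^bsub>affine_hecke q\<^esub> hecke_class q b"
  and hecke_class_mult: "hecke_class q (a * b) = hecke_class q a \<otimes>\<^bsub>affine_hecke q\<^esub> hecke_class q b"
  and hecke_class_one: "hecke_class q 1 = \<one>\<^bsub>affine_hecke q\<^esub>"
  using ring_hom_add[OF hecke_class_hom[of q], of a b] ring_hom_mult[OF hecke_class_hom[of q], of a b]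
    ring_hom_one[OF hecke_class_hom[of q]]
  by (simp_all add: free_ring_simps)

lemma hecke_class_zero: "hecke_class q 0 = \<zero>\<^bsub>affine_hecke q\<^esub>"
  using ring_hom_zero[OF hecke_class_hom[of q] ring_free_ring ring_affine_hecke]
  by (simp add: free_ring_simps)

lemma hecke_class_eq: "hecke_class q a = hecke_class q b \<longleftrightarrow> a - b \<in> hecke_ideal q"
  using ring.quotient_eq_iff_same_a_r_cos[OF ring_free_ring ideal_hecke_ideal[of q], of a b]
  by (simp add: free_ring_simps free_ring_minus hecke_class_def)

lemma hecke_rels_ideal: "a \<in> hecke_rels q \<Longrightarrow> a \<in> hecke_ideal q"
  unfolding hecke_ideal_def
  using ring.genideal_self[OF ring_free_ring, of "hecke_rels q"] by (auto simp: free_ring_simps)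

lemma hecke_class_rel:
  assumes "a - b \<in> hecke_rels q"
  shows "hecke_class q a = hecke_class q b"
  using hecke_rels_ideal[OF assms] by (simp add: hecke_class_eq)

lemma hecke_class_uminus: "hecke_class q (- a) = \<ominus>\<^bsub>affine_hecke q\<^esub> hecke_class q a"
proof (rule sym, rule abelian_group.minus_equality[OF ring.is_abelian_group[OF ring_affine_hecke]])
  show "hecke_class q (- a) \<oplus>\<^bsub>affine_hecke q\<^esub> hecke_class q a = \<zero>\<^bsub>affine_hecke q\<^esub>"
    by (simp flip: hecke_class_add hecke_class_zero)
qed simp_all

lemma hecke_ideal_minimal:
  assumes "hecke_rels q \<subseteq> J" and "0 \<in> J" and "\<And>a b. a \<in> J \<Longrightarrow> b \<in> J \<Longrightarrow> a - b \<in> J"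
    and "\<And>a b. a \<in> J \<Longrightarrow> b * a \<in> J" and "\<And>a b. a \<in> J \<Longrightarrow> a * b \<in> J"
  shows "hecke_ideal q \<subseteq> J"
  unfolding hecke_ideal_def
proof (rule ring.genideal_minimal[OF ring_free_ring _ assms(1)])
  have uminus: "- a \<in> J" if "a \<in> J" for a using assms(3)[OF assms(2) that] by simp
  have add: "a + b \<in> J" if "a \<in> J" "b \<in> J" for a b
    using assms(3)[OF that(1) uminus[OF that(2)]] by simp
  show "ideal J free_ring"
  proof (rule idealI[OF ring_free_ring])
    show "subgroup J (add_monoid free_ring)"
    proof (rule group.subgroupI[OF abelian_group.a_group[OF ring.is_abelian_group[OF ring_free_ring]]])
      show "inv\<^bsub>add_monoid free_ring\<^esub> a \<in> J" if "a \<in> J" for a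
        using uminus[OF that] free_ring_uminus[of a] by (simp add: a_inv_def)
    qed (use assms(2) add in \<open>auto simp: free_ring_simps\<close>)
  qed (use assms(4,5) in \<open>simp_all add: free_ring_simps\<close>)
qed

lemma const_mult: "const c * const d = const (c * d)" and const_add: "const c + const d = const (c + d)"
  and const_one: "const 1 = 1" and const_zero: "const 0 = 0"
  by (simp_all add: const_def mult_single single_add)

lemma const_commute: "const c * a = a * const c"
  by (induction a rule: poly_mapping_additive_induct)
    (simp_all add: const_def mult_single distrib_left distrib_right mult.commute)

lemma hecke_class_scalar: "hecke_class q (of_group_alg (Poly_Mapping.single 0 c)) = Hscal q c"
proof -
  have "hecke_class q (gen (GenX 0)) = hecke_class q 1"
    by (rule hecke_class_rel) (simp add: hecke_rels_def)
  then have "hecke_class q (const c * gen (GenX 0)) = hecke_class q (const c)"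
    by (metis hecke_class_mult mult_1_right)
  moreover have "of_group_alg (Poly_Mapping.single 0 c) = const c * gen (GenX 0)"
    by (simp add: of_group_alg_def const_zero)
  ultimately show ?thesis by simp
qed

lemma carrier_hecke_sub_subset: "carrier (hecke_sub q i) \<subseteq> carrier (affine_hecke q)"
  unfolding hecke_sub_def
  using ring.generate_ring_incl[OF ring_affine_hecke[of q], of "insert (HT q i) (range (\<lambda>f. hecke_class q (of_group_alg f)))"]
  by (simp add: image_subset_iff)

lemma hecke_sub_ops:
  "a \<otimes>\<^bsub>hecke_sub q i\<^esub> b = a \<otimes>\<^bsub>affine_hecke q\<^esub> b" "a \<oplus>\<^bsub>hecke_sub q i\<^esub> b = a \<oplus>\<^bsub>affine_hecke q\<^esub> b"
  "\<one>\<^bsub>hecke_sub q i\<^esub> = \<one>\<^bsub>affine_hecke q\<^esub>"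
  by (simp_all add: hecke_sub_def)

lemma hecke_sub_closed:
  shows "HT q i \<in> carrier (hecke_sub q i)"
    and "hecke_class q (of_group_alg f) \<in> carrier (hecke_sub q i)"
    and "Hscal q c \<in> carrier (hecke_sub q i)"
    and "HX q l \<in> carrier (hecke_sub q i)"
    and "a \<in> carrier (hecke_sub q i) \<Longrightarrow> b \<in> carrier (hecke_sub q i) \<Longrightarrow>
      a \<otimes>\<^bsub>affine_hecke q\<^esub> b \<in> carrier (hecke_sub q i)"
    and "a \<in> carrier (hecke_sub q i) \<Longrightarrow> b \<in> carrier (hecke_sub q i) \<Longrightarrow>
      a \<oplus>\<^bsub>affine_hecke q\<^esub> b \<in> carrier (hecke_sub q i)"
proof -
  show *: "hecke_class q (of_group_alg f) \<in> carrier (hecke_sub q i)" for f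
    unfolding hecke_sub_def by (auto intro: generate_ring.incl)
  show "Hscal q c \<in> carrier (hecke_sub q i)"
    using *[of "Poly_Mapping.single 0 c"] by (simp only: hecke_class_scalar)
  have "of_group_alg (Poly_Mapping.single l 1) = gen (GenX l)"
    by (simp add: of_group_alg_def const_one)
  then show "HX q l \<in> carrier (hecke_sub q i)"
    using *[of "Poly_Mapping.single l 1"] by simp
qed (auto simp: hecke_sub_def intro: generate_ring.intros)

section \<open>The six-dimensional representation of the Hecke algebra\<close>

text \<open>The generator \<open>T\<^sub>i\<close> acts by \<open>\<epsilon>\<close> times the operator with parameter \<open>z = \<epsilon>q\<close>; the eigenvalue of \<open>T\<^sub>1\<close> on the
first unit vector is then \<open>\<epsilon>z = q\<close>.\<close>

locale g2_representation =
  fixes q \<epsilon> :: complex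
  assumes q0: "q \<noteq> 0" and eps: "\<epsilon> \<in> {1, -1}"
begin

abbreviation z :: complex where "z \<equiv> \<epsilon> * q"

lemma eps_square: "\<epsilon> * \<epsilon> = 1" using eps by auto

sublocale ops: g2_operators z
  using q0 eps by unfold_locales auto

lemma kappa: "q - inverse q = \<epsilon> * (z - inverse z)"
  using eps by auto

fun act :: "generator \<Rightarrow> vec6 \<Rightarrow> vec6" where
  "act (GenT i) = (\<lambda>x. vscale \<epsilon> (ops.T i x))"
| "act (GenX l) = ops.Xop l"

sublocale word_action act
proof
  show "linear_op (act g)" for g
  proof (cases g)
    case (GenT i)
    then show ?thesis
      using linear_op_add[OF ops.linear_T[of i]] linear_op_scale[OF ops.linear_T[of i]]
      by (intro linear_opI) (simp_all add: vscale_add vscale_vscale mult.commute)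
  qed (simp add: ops.linear_X)
qed

lemma rep_rels:
  assumes "a \<in> hecke_rels q"
  shows "rep a x = 0"
proof -
  have T: "rep (gen (GenT i)) y = vscale \<epsilon> (ops.T i y)" for i y by (simp add: rep_gen)
  have X: "rep (gen (GenX l)) y = ops.Xop l y" for l y by (simp add: rep_gen)
  note ops = rep_diff rep_add rep_mult rep_one rep_const T X vscale_vscale vscale_add
    linear_op_add[OF ops.linear_T] linear_op_scale[OF ops.linear_T] linear_op_scale[OF ops.linear_X]
  have e: "\<epsilon> * (\<epsilon> * c) = c" for c using eps_square by (simp flip: mult.assoc)
  consider (unit) "a = gen (GenX 0) - 1"
    | (add) l m where "a = gen (GenX l) * gen (GenX m) - gen (GenX (l + m))"
    | (quad) i where "a = gen (GenT i) * gen (GenT i) - (const (q - inverse q) * gen (GenT i) + 1)"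
    | (braid) "a = gen (GenT N1) * gen (GenT N2) * gen (GenT N1) * gen (GenT N2) * gen (GenT N1) * gen (GenT N2)
      - gen (GenT N2) * gen (GenT N1) * gen (GenT N2) * gen (GenT N1) * gen (GenT N2) * gen (GenT N1)"
    | (bernstein) i l f where "is_bernstein_quotient i l f"
      "a = gen (GenX l) * gen (GenT i)
        - (gen (GenT i) * gen (GenX (simple_refl i l)) + const (q - inverse q) * of_group_alg f)"
    using assms unfolding hecke_rels_def by blast
  then show ?thesis
  proof cases
    case unit
    then show ?thesis by (simp add: ops ops.X_zero)
  next
    case add
    then show ?thesis by (simp add: ops ops.X_add)
  next
    case quad
    have "ops.T i (ops.T i x) = vscale (z - inverse z) (ops.T i x) + x"
      by (cases i) (simp_all add: ops.T1_square ops.T2_square)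
    then show ?thesis
      by (simp add: quad ops kappa eps_square vscale_one mult_ac e del: mult.assoc)
  next
    case braid
    then show ?thesis
      by (simp add: ops ops.braid linear_op_scale[OF ops.linear_T1] linear_op_scale[OF ops.linear_T2])
  next
    case bernstein
    have "rep (of_group_alg f) x = ops.Xalg f x"
      by (simp add: rep_of_group_alg ops.Xalg_def)
    then show ?thesis
      by (simp add: bernstein(2) ops kappa ops.bernstein_relation[OF bernstein(1)])
  qed
qed

lemma rep_ideal:
  assumes "a \<in> hecke_ideal q"
  shows "rep a x = 0"
proof -
  have "hecke_ideal q \<subseteq> {a. \<forall>x. rep a x = 0}"
    by (rule hecke_ideal_minimal)
      (auto simp: rep_rels rep_zero rep_diff rep_mult linear_op_zero[OF linear_rep] simp del: split_paired_All)
  then show ?thesis using assms by blast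
qed

lemma rep_cong: "hecke_class q a = hecke_class q b \<Longrightarrow> rep a x = rep b x"
  using rep_ideal[of "a - b" x] by (simp add: hecke_class_eq rep_diff)

definition weight :: "root_lattice \<Rightarrow> complex" where
  "weight l = z powi (2 * fst l - 3 * snd l)"

lemma act_X_unit_vec: "ops.Xop l (ops.unit_vec 0) = vscale (weight l) (ops.unit_vec 0)"
proof -
  have z: "z \<noteq> 0" by (rule ops.z0)
  have *: "ipow f g k (ops.unit_vec 0) = vscale (c powi k) (ops.unit_vec 0)"
    if "linear_op f" "linear_op g" "f (ops.unit_vec 0) = vscale c (ops.unit_vec 0)" "inverse_pair f g" "c \<noteq> 0" for f g c k
  proof (induction k rule: int_induct[of _ 0])
    case base
    then show ?case by (simp add: ipow_simps vscale_one)
  next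
    case (step1 i)
    then show ?case
      using that by (simp add: inverse_pair.ipow_succ linear_op_scale vscale_vscale power_int_add)
  next
    case (step2 i)
    have "g (vscale c (ops.unit_vec 0)) = ops.unit_vec 0"
      using that(3,4) by (metis inverse_pair.gf)
    then have "vscale (inverse c) (vscale c (g (ops.unit_vec 0))) = vscale (inverse c) (ops.unit_vec 0)"
      using that(2) by (simp add: linear_op_scale)
    then have "g (ops.unit_vec 0) = vscale (inverse c) (ops.unit_vec 0)"
      using that(5) by (simp add: vscale_vscale vscale_one)
    then show ?case
      using that step2 by (simp add: inverse_pair.ipow_pred linear_op_scale vscale_vscale power_int_diff divide_inverse)
  qed
  have Y: "ops.Y (ops.unit_vec 0) = vscale z (ops.unit_vec 0)"
    by (simp add: ops.Y_def ops.unit_vec_def vscale_def)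
  have Z: "ops.Z (ops.unit_vec 0) = vscale (inverse z) (ops.unit_vec 0)"
    by (simp add: ops.Z_eq_matrix ops.Z_matrix_def ops.unit_vec_def vscale_def)
  have "ops.Xop l (ops.unit_vec 0) = vscale (inverse z powi (2 * snd l - fst l) * z powi (fst l - snd l)) (ops.unit_vec 0)"
    unfolding ops.Xop_def
    using z *[OF ops.linear_Y ops.linear_Y_inv Y ops.Yp.inverse_pair_axioms]
      *[OF ops.linear_Z ops.linear_Z_inv Z ops.Zp.inverse_pair_axioms]
    by (simp add: linear_op_scale[OF linear_op_ipow[OF ops.linear_Y ops.linear_Y_inv]] vscale_vscale)
  also have "inverse z powi (2 * snd l - fst l) * z powi (fst l - snd l) = weight l"
    using z by (simp only: power_int_inverse flip: power_int_minus power_int_add)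
      (simp add: weight_def flip: power_int_add power_int_minus)
  finally show ?thesis .
qed

lemma act_T1_unit_vec: "act (GenT N1) (ops.unit_vec 0) = vscale q (ops.unit_vec 0)"
  using eps_square by (simp add: ops.T1_def ops.unit_vec_def vscale_def flip: mult.assoc)

text \<open>The elements \<open>T\<^sub>w\<close> for the minimal representatives \<open>w\<close> of the cosets of \<open>\<langle>s\<^sub>1\<rangle>\<close> in \<open>W\<^sub>0\<close>, numbered by the length of
\<open>w\<close>; the index stays below \<open>6\<close>.\<close>

fun std_word :: "nat \<Rightarrow> free_alg" where
  "std_word 0 = 1"
| "std_word (Suc n) = gen (GenT (if even n then N2 else N1)) * std_word n"

lemma act_T_unit_vec: "i < 5 \<Longrightarrow>
    act (GenT (if even i then N2 else N1)) (ops.unit_vec i) = vscale \<epsilon> (ops.unit_vec (Suc i))"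
proof -
  assume "i < 5"
  then have "i = 0 \<or> i = 1 \<or> i = 2 \<or> i = 3 \<or> i = 4" by auto
  then show ?thesis
    by (elim disjE) (simp_all add: ops.T1_def ops.T2_def ops.unit_vec_def vscale_def)
qed

lemma rep_std_word: "i < 6 \<Longrightarrow> rep (std_word i) (ops.unit_vec 0) = vscale (\<epsilon> ^ i) (ops.unit_vec i)"
proof (induction i)
  case 0
  then show ?case by (simp add: rep_one vscale_one)
next
  case (Suc i)
  have "rep (std_word (Suc i)) (ops.unit_vec 0) =
      act (GenT (if even i then N2 else N1)) (vscale (\<epsilon> ^ i) (ops.unit_vec i))"
    using Suc by (simp only: std_word.simps rep_mult rep_gen)
  also have "\<dots> = vscale (\<epsilon> ^ i) (act (GenT (if even i then N2 else N1)) (ops.unit_vec i))"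
    by (rule linear_op_scale[OF linear_act])
  also have "\<dots> = vscale (\<epsilon> ^ Suc i) (ops.unit_vec (Suc i))"
    using Suc.prems by (simp only: act_T_unit_vec vscale_vscale) (simp add: mult.commute)
  finally show ?case .
qed

text \<open>If the last nonzero coordinate of a vector is the one at \<open>k < 5\<close>, then \<open>T\<^sub>2\<close> (for even \<open>k\<close>) or \<open>T\<^sub>1\<close> (for odd
\<open>k\<close>) moves it to the place \<open>k + 1\<close>, up to the sign \<open>\<epsilon>\<close>.\<close>

lemma raise_to_top:
  assumes "x \<noteq> 0"
  shows "\<exists>b. snd (snd (snd (snd (snd (rep b x))))) \<noteq> 0"
proof -
  obtain x0 x1 x2 x3 x4 x5 where x: "x = (x0, x1, x2, x3, x4, x5)" by (cases x)
  let ?t1 = "gen (GenT N1)" and ?t2 = "gen (GenT N2)"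
  have e: "\<epsilon> \<noteq> 0" using eps by auto
  note simps = rep_one rep_mult rep_gen ops.T1_def ops.T2_def vscale_def x e
  show ?thesis
  proof (cases "x5 = 0")
    case False then show ?thesis by (intro exI[of _ 1]) (simp add: simps)
  next
    case 5: True
    show ?thesis
    proof (cases "x4 = 0")
      case False then show ?thesis using 5 by (intro exI[of _ ?t2]) (simp add: simps)
    next
      case 4: True
      show ?thesis
      proof (cases "x3 = 0")
        case False then show ?thesis using 4 5 by (intro exI[of _ "?t2 * ?t1"]) (simp add: simps)
      next
        case 3: True
        show ?thesis
        proof (cases "x2 = 0")
          case False then show ?thesis using 3 4 5
            by (intro exI[of _ "?t2 * (?t1 * ?t2)"]) (simp add: simps)
        next
          case 2: True
          show ?thesis
          proof (cases "x1 = 0")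
            case False then show ?thesis using 2 3 4 5
              by (intro exI[of _ "?t2 * (?t1 * (?t2 * ?t1))"]) (simp add: simps)
          next
            case 1: True
            then have "x0 \<noteq> 0" using assms 2 3 4 5 x by (simp add: zero_prod_def)
            then show ?thesis using 1 2 3 4 5
              by (intro exI[of _ "?t2 * (?t1 * (?t2 * (?t1 * ?t2)))"]) (simp add: simps)
          qed
        qed
      qed
    qed
  qed
qed

lemma generate_unit_vec:
  assumes "x \<noteq> 0" and "z ^ 2 \<noteq> 1" and "z ^ 5 \<noteq> 1"
  shows "\<exists>b. rep b x = ops.unit_vec 0"
proof -
  obtain b where b: "snd (snd (snd (snd (snd (rep b x))))) \<noteq> 0" using raise_to_top[OF assms(1)] ..
  define c where "c = inverse z * (1 - z) * (1 - z ^ 2) * (1 - z ^ 5) * snd (snd (snd (snd (snd (rep b x)))))"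
  have "z \<noteq> 1" using assms(2) by auto
  then have c: "c \<noteq> 0" using b assms(2,3) ops.z0 by (simp add: c_def)
  let ?Y = "gen (GenX (2, 1))" and ?Z = "gen (GenX (1, 1))"
  let ?a = "(?Y - const (z ^ 2)) * ((?Y - const z) * (?Z - const (z ^ 2)))"
  have "rep ?a (rep b x) = ops.socle_op (rep b x)"
    by (simp add: rep_mult rep_diff rep_const rep_gen ops.X_21 ops.X_11 ops.socle_op_def Let_def)
  also have "\<dots> = vscale c (ops.unit_vec 0)" unfolding c_def by (rule ops.socle_op_explicit)
  finally have "rep (const (inverse c) * (?a * b)) x = ops.unit_vec 0"
    using c by (simp only: rep_mult[of _ "?a * b"] rep_mult[of ?a] rep_const vscale_vscale)
      (simp add: vscale_one)
  then show ?thesis ..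
qed

end

locale g2_induced_module = g2_representation +
  fixes V :: "(free_alg set, 'v) module" and v :: 'v
  assumes line: "is_weight_line q N1 q weight V v"
begin

abbreviation "H \<equiv> affine_hecke q"
abbreviation "S \<equiv> hecke_sub q N1"
abbreviation cl :: "free_alg \<Rightarrow> free_alg set" where "cl \<equiv> hecke_class q"

lemma V_module: "left_module S V"
  and v_closed: "v \<in> carrier V"
  and v_nonzero: "v \<noteq> \<zero>\<^bsub>V\<^esub>"
  and carrier_V: "carrier V = range (\<lambda>c. Hscal q c \<odot>\<^bsub>V\<^esub> v)"
  and T_v: "HT q N1 \<odot>\<^bsub>V\<^esub> v = Hscal q q \<odot>\<^bsub>V\<^esub> v"
  and X_v: "HX q l \<odot>\<^bsub>V\<^esub> v = Hscal q (weight l) \<odot>\<^bsub>V\<^esub> v"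
  using line unfolding is_weight_line_def by blast+

sublocale ind: cyclic_induction H S V v
proof (intro cyclic_induction.intro cyclic_induction_axioms.intro)
  show "Ring.ring H" by (rule ring_affine_hecke)
  show "carrier S \<subseteq> carrier H" by (rule carrier_hecke_sub_subset)
  show "left_module S V" by (rule V_module)
  show "v \<in> carrier V" by (rule v_closed)
  show "\<exists>s\<in>carrier S. x = s \<odot>\<^bsub>V\<^esub> v" if "x \<in> carrier V" for x
    using that hecke_sub_closed(3) unfolding carrier_V by blast
qed

section \<open>The inducing line inside the representation\<close>

lemma V_mult: "cl a \<in> carrier S \<Longrightarrow> cl b \<in> carrier S \<Longrightarrow> x \<in> carrier V \<Longrightarrow>
    cl (a * b) \<odot>\<^bsub>V\<^esub> x = cl a \<odot>\<^bsub>V\<^esub> (cl b \<odot>\<^bsub>V\<^esub> x)"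
  using left_module.smult_assoc[OF V_module, of "cl a" "cl b" x] by (simp add: hecke_sub_ops hecke_class_mult)

lemma V_plus: "cl a \<in> carrier S \<Longrightarrow> cl b \<in> carrier S \<Longrightarrow> x \<in> carrier V \<Longrightarrow>
    cl (a + b) \<odot>\<^bsub>V\<^esub> x = cl a \<odot>\<^bsub>V\<^esub> x \<oplus>\<^bsub>V\<^esub> cl b \<odot>\<^bsub>V\<^esub> x"
  using left_module.smult_l_distr[OF V_module, of "cl a" "cl b" x] by (simp add: hecke_sub_ops hecke_class_add)

lemma V_one: "x \<in> carrier V \<Longrightarrow> Hscal q 1 \<odot>\<^bsub>V\<^esub> x = x"
  using left_module.smult_one[OF V_module, of x] by (simp add: hecke_sub_ops const_one hecke_class_one)

lemma cl_S: "Hscal q c \<in> carrier S" "HT q N1 \<in> carrier S" "HX q l \<in> carrier S"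
  "cl a \<in> carrier S \<Longrightarrow> cl b \<in> carrier S \<Longrightarrow> cl (a * b) \<in> carrier S"
  "cl a \<in> carrier S \<Longrightarrow> cl b \<in> carrier S \<Longrightarrow> cl (a + b) \<in> carrier S"
  using hecke_sub_closed(5,6)[of _ q N1]
  by (simp_all add: hecke_sub_closed(1,3,4) hecke_class_mult hecke_class_add)

definition common_eigenvalue :: "free_alg \<Rightarrow> complex \<Rightarrow> bool" where
  "common_eigenvalue a d \<longleftrightarrow> cl a \<in> carrier S \<and> cl a \<odot>\<^bsub>V\<^esub> v = Hscal q d \<odot>\<^bsub>V\<^esub> v \<and>
     rep a (ops.unit_vec 0) = vscale d (ops.unit_vec 0)"

lemma eigenvalue_const: "common_eigenvalue (const c) c"
  by (simp add: common_eigenvalue_def cl_S rep_const)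

lemma eigenvalue_add: "common_eigenvalue a c \<Longrightarrow> common_eigenvalue b d \<Longrightarrow> common_eigenvalue (a + b) (c + d)"
  unfolding common_eigenvalue_def
  by (simp add: cl_S V_plus v_closed rep_add vscale_add_left flip: const_add)

lemma eigenvalue_mult:
  assumes "common_eigenvalue a c" "common_eigenvalue b d"
  shows "common_eigenvalue (a * b) (c * d)"
proof -
  have a: "cl a \<in> carrier S" "cl a \<odot>\<^bsub>V\<^esub> v = Hscal q c \<odot>\<^bsub>V\<^esub> v" "rep a (ops.unit_vec 0) = vscale c (ops.unit_vec 0)"
    and b: "cl b \<in> carrier S" "cl b \<odot>\<^bsub>V\<^esub> v = Hscal q d \<odot>\<^bsub>V\<^esub> v" "rep b (ops.unit_vec 0) = vscale d (ops.unit_vec 0)"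
    using assms unfolding common_eigenvalue_def by auto
  have "cl (a * b) \<odot>\<^bsub>V\<^esub> v = cl (a * const d) \<odot>\<^bsub>V\<^esub> v"
    using a b by (simp add: V_mult cl_S v_closed)
  also have "\<dots> = cl (const d * a) \<odot>\<^bsub>V\<^esub> v" by (simp only: const_commute)
  also have "\<dots> = cl (const d * const c) \<odot>\<^bsub>V\<^esub> v"
    using a by (simp add: V_mult cl_S v_closed)
  finally have "cl (a * b) \<odot>\<^bsub>V\<^esub> v = Hscal q (c * d) \<odot>\<^bsub>V\<^esub> v"
    by (simp add: const_mult mult.commute)
  then show ?thesis
    using a b unfolding common_eigenvalue_def
    by (simp add: cl_S rep_mult linear_op_scale[OF linear_rep] vscale_vscale mult.commute)
qed

lemma eigenvalue_sum: "finite A \<Longrightarrow> (\<And>x. x \<in> A \<Longrightarrow> common_eigenvalue (f x) (g x)) \<Longrightarrow>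
    common_eigenvalue (sum f A) (sum g A)"
  by (induction A rule: finite_induct) (simp_all add: eigenvalue_add eigenvalue_const[of 0, unfolded const_zero])

lemma eigenvalue_T1: "common_eigenvalue (gen (GenT N1)) q"
  using act_T1_unit_vec by (simp add: common_eigenvalue_def cl_S T_v rep_gen del: act.simps)

lemma eigenvalue_X: "common_eigenvalue (gen (GenX l)) (weight l)"
  by (simp add: common_eigenvalue_def cl_S X_v rep_gen act_X_unit_vec)

text \<open>The line of the first unit vector is isomorphic to \<open>\<complex>v\<close>: the elements that act on both by the same scalar
form a subring which contains the generators.\<close>

lemma common_eigenvalue_exists:
  assumes "s \<in> carrier S"
  shows "\<exists>a d. s = cl a \<and> common_eigenvalue a d"
proof -
  have "s \<in> generate_ring H (insert (HT q N1) (range (\<lambda>f. cl (of_group_alg f))))"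
    using assms by (simp add: hecke_sub_def)
  then show ?thesis
  proof (induction rule: generate_ring.induct)
    case one
    then show ?case using eigenvalue_const[of 1] by (metis const_one hecke_class_one)
  next
    case (incl h)
    have "\<exists>d. common_eigenvalue (of_group_alg f) d" for f
      unfolding of_group_alg_def
      by (rule exI, rule eigenvalue_sum[OF finite_keys eigenvalue_mult[OF eigenvalue_const eigenvalue_X]])
    then show ?case using incl eigenvalue_T1 by blast
  next
    case (a_inv h)
    then obtain a d where a: "h = cl a" "common_eigenvalue a d" by blast
    have "\<ominus>\<^bsub>H\<^esub> h = cl (const (- 1) * a)"
      using a const_add[of "-1" 1]
      by (simp add: const_zero const_one flip: hecke_class_uminus eq_neg_iff_add_eq_0)
    then show ?case using eigenvalue_mult[OF eigenvalue_const a(2)] by blast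
  next
    case (eng_add h1 h2)
    then show ?case using eigenvalue_add by (metis hecke_class_add)
  next
    case (eng_mult h1 h2)
    then show ?case using eigenvalue_mult by (metis hecke_class_mult)
  qed
qed

lemma scalar_inject:
  assumes "Hscal q c \<odot>\<^bsub>V\<^esub> v = Hscal q d \<odot>\<^bsub>V\<^esub> v"
  shows "c = d"
proof (rule ccontr)
  interpret V: left_module S V by (rule V_module)
  have scal: "Hscal q (a + b) \<odot>\<^bsub>V\<^esub> v = Hscal q a \<odot>\<^bsub>V\<^esub> v \<oplus>\<^bsub>V\<^esub> Hscal q b \<odot>\<^bsub>V\<^esub> v" for a b
    by (simp add: V_plus cl_S v_closed flip: const_add)
  have zero: "Hscal q 0 \<odot>\<^bsub>V\<^esub> v = \<zero>\<^bsub>V\<^esub>"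
  proof -
    have "Hscal q 0 \<odot>\<^bsub>V\<^esub> v \<oplus>\<^bsub>V\<^esub> Hscal q 0 \<odot>\<^bsub>V\<^esub> v = Hscal q 0 \<odot>\<^bsub>V\<^esub> v"
      using scal[of 0 0] by simp
    then show ?thesis
      using V.M.add.l_cancel_one[of "Hscal q 0 \<odot>\<^bsub>V\<^esub> v" "Hscal q 0 \<odot>\<^bsub>V\<^esub> v"] V.smult_closed cl_S v_closed
      by metis
  qed
  assume "c \<noteq> d"
  let ?k = "inverse (c - d)"
  have "Hscal q (c - d) \<odot>\<^bsub>V\<^esub> v = Hscal q c \<odot>\<^bsub>V\<^esub> v \<oplus>\<^bsub>V\<^esub> Hscal q (- d) \<odot>\<^bsub>V\<^esub> v"
    by (simp flip: scal)
  also have "\<dots> = \<zero>\<^bsub>V\<^esub>" unfolding assms by (simp add: zero flip: scal)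
  finally have "Hscal q (?k * (c - d)) \<odot>\<^bsub>V\<^esub> v = Hscal q ?k \<odot>\<^bsub>V\<^esub> (Hscal q 0 \<odot>\<^bsub>V\<^esub> v)"
    by (simp add: V_mult cl_S v_closed zero flip: const_mult)
  also have "\<dots> = Hscal q (?k * 0) \<odot>\<^bsub>V\<^esub> v"
    by (simp only: V_mult cl_S v_closed flip: const_mult)
  finally have "v = \<zero>\<^bsub>V\<^esub>"
    using \<open>c \<noteq> d\<close> V_one[OF v_closed] zero by simp
  then show False using v_nonzero by simp
qed

definition coord :: "'v \<Rightarrow> complex" where
  "coord x = (THE c. x = Hscal q c \<odot>\<^bsub>V\<^esub> v)"

lemma coord_eq: "coord (Hscal q c \<odot>\<^bsub>V\<^esub> v) = c"
  unfolding coord_def by (rule the_equality) (use scalar_inject in auto)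

text \<open>The choice of the representative is immaterial since the representation annihilates the ideal.\<close>

definition repH :: "free_alg set \<Rightarrow> vec6 \<Rightarrow> vec6" where
  "repH r = rep (SOME a. cl a = r)"

lemma repH_eq: "repH (cl a) x = rep a x"
  unfolding repH_def by (rule rep_cong) (rule someI[of _ a], rule refl)

text \<open>The map \<open>r \<otimes> c v \<mapsto> r \<cdot> c e\<^sub>0\<close> from the induced module to \<open>\<complex>\<^sup>6\<close> is well defined; followed by a coordinate that
does not vanish on \<open>a e\<^sub>0\<close> it becomes a functional to which \<open>ind.pure_nonzeroI\<close> applies.\<close>

lemma rep_zero_if_pure_zero:
  assumes "ind.pure (cl a) = \<zero>\<^bsub>ind.M\<^esub>"
  shows "rep a (ops.unit_vec 0) = 0"
proof (rule ccontr)
  assume "rep a (ops.unit_vec 0) \<noteq> 0"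
  then have "\<exists>p :: vec6 \<Rightarrow> complex. (\<forall>x y. p (x + y) = p x + p y) \<and> p (rep a (ops.unit_vec 0)) \<noteq> 0"
    by (cases "rep a (ops.unit_vec 0)") (auto simp: zero_prod_def simp del: split_paired_All
      intro: exI[of _ fst] exI[of _ "\<lambda>x. fst (snd x)"] exI[of _ "\<lambda>x. fst (snd (snd x))"]
        exI[of _ "\<lambda>x. fst (snd (snd (snd x)))"] exI[of _ "\<lambda>x. fst (snd (snd (snd (snd x))))"]
        exI[of _ "\<lambda>x. snd (snd (snd (snd (snd x))))"])
  then obtain p :: "vec6 \<Rightarrow> complex" where p: "\<And>x y. p (x + y) = p x + p y" "p (rep a (ops.unit_vec 0)) \<noteq> 0"
    by blast
  define \<phi> where "\<phi> r x = p (repH r (vscale (coord x) (ops.unit_vec 0)))" for r x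
  have "ind.pure (cl a) \<noteq> \<zero>\<^bsub>ind.M\<^esub>"
  proof (rule ind.pure_nonzeroI[where \<phi> = \<phi>])
    show "\<phi> (cl a) v \<noteq> 0"
      using coord_eq[of 1] p(2) by (simp add: \<phi>_def V_one v_closed vscale_one repH_eq)
  next
    fix r r' x assume "r \<in> carrier H" "r' \<in> carrier H"
    then obtain a b where "r = cl a" "r' = cl b" unfolding carrier_affine_hecke by blast
    then show "\<phi> (r \<oplus>\<^bsub>H\<^esub> r') x = \<phi> r x + \<phi> r' x"
      by (simp add: \<phi>_def repH_eq rep_add p(1) flip: hecke_class_add)
  next
    fix r x x' assume "r \<in> carrier H" "x \<in> carrier V" "x' \<in> carrier V"
    then obtain a c d where "r = cl a" "x = Hscal q c \<odot>\<^bsub>V\<^esub> v" "x' = Hscal q d \<odot>\<^bsub>V\<^esub> v"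
      unfolding carrier_affine_hecke carrier_V by blast
    moreover have "Hscal q c \<odot>\<^bsub>V\<^esub> v \<oplus>\<^bsub>V\<^esub> Hscal q d \<odot>\<^bsub>V\<^esub> v = Hscal q (c + d) \<odot>\<^bsub>V\<^esub> v"
      by (simp add: V_plus cl_S v_closed flip: const_add)
    ultimately show "\<phi> r (x \<oplus>\<^bsub>V\<^esub> x') = \<phi> r x + \<phi> r x'"
      by (simp add: \<phi>_def repH_eq coord_eq vscale_add_left linear_op_add[OF linear_rep] p(1))
  next
    fix r s x assume "r \<in> carrier H" "s \<in> carrier S" "x \<in> carrier V"
    then obtain a b c d where *: "r = cl a" "s = cl b" "common_eigenvalue b d" "x = Hscal q c \<odot>\<^bsub>V\<^esub> v"
      unfolding carrier_affine_hecke carrier_V using common_eigenvalue_exists by blast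
    have "s \<odot>\<^bsub>V\<^esub> x = cl (b * const c) \<odot>\<^bsub>V\<^esub> v"
      using * by (simp add: V_mult cl_S v_closed common_eigenvalue_def)
    also have "\<dots> = Hscal q (d * c) \<odot>\<^bsub>V\<^esub> v"
      using eigenvalue_mult[OF *(3) eigenvalue_const[of c]] by (simp add: common_eigenvalue_def)
    finally have "coord (s \<odot>\<^bsub>V\<^esub> x) = d * c" by (simp only: coord_eq)
    moreover have "rep b (ops.unit_vec 0) = vscale d (ops.unit_vec 0)" using * by (simp add: common_eigenvalue_def)
    ultimately show "\<phi> (r \<otimes>\<^bsub>H\<^esub> s) x = \<phi> r (s \<odot>\<^bsub>V\<^esub> x)"
      using * by (simp add: \<phi>_def repH_eq coord_eq rep_mult linear_op_scale[OF linear_rep]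
          vscale_vscale mult.commute flip: hecke_class_mult)
  qed
  then show False using assms by simp
qed

section \<open>Six spanning tensors\<close>

definition tens :: "free_alg \<Rightarrow> (free_alg set \<times> 'v \<Rightarrow>\<^sub>0 int) set" where
  "tens a = ind.pure (cl a)"

lemma tens_add: "tens (a + b) = tens a \<oplus>\<^bsub>ind.M\<^esub> tens b"
  by (simp add: tens_def hecke_class_add ind.pure_add)

lemma tens_mult: "tens (a * b) = cl a \<odot>\<^bsub>ind.M\<^esub> tens b"
  by (simp add: tens_def hecke_class_mult ind.pure_smult)

lemma tens_zero: "tens 0 = \<zero>\<^bsub>ind.M\<^esub>"
  by (simp add: tens_def hecke_class_zero ind.pure_zero)

lemma tens_mult_cong: "tens b = tens c \<Longrightarrow> tens (a * b) = tens (a * c)"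
  by (simp add: tens_mult)

lemma tens_add_cong: "tens a = tens b \<Longrightarrow> tens c = tens d \<Longrightarrow> tens (a + c) = tens (b + d)"
  by (simp add: tens_add)

lemma tens_rel:
  assumes "a - b \<in> hecke_rels q"
  shows "tens (a * c) = tens (b * c)"
  using hecke_class_rel[OF assms] by (simp add: tens_def hecke_class_mult)

lemma tens_eigen:
  assumes "common_eigenvalue a d"
  shows "tens a = tens (const d)"
proof -
  have "tens b = ind.tclass (frag_of (cl 1, cl b \<odot>\<^bsub>V\<^esub> v))" if "cl b \<in> carrier S" for b
    using ind.pure_balance[OF hecke_class_closed[of q 1] that] by (simp add: tens_def flip: hecke_class_mult)
  then show ?thesis using assms by (simp add: common_eigenvalue_def cl_S)
qed

definition spanned :: "free_alg set" where
  "spanned = {a. \<exists>c. tens a = tens (\<Sum>i<6. const (c i) * std_word i)}"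

lemma spanned_cong: "tens a = tens b \<Longrightarrow> b \<in> spanned \<Longrightarrow> a \<in> spanned"
  by (simp add: spanned_def)

lemma spanned_add:
  assumes "a \<in> spanned" "b \<in> spanned"
  shows "a + b \<in> spanned"
proof -
  obtain c d where "tens a = tens (\<Sum>i<6. const (c i) * std_word i)"
      "tens b = tens (\<Sum>i<6. const (d i) * std_word i)"
    using assms unfolding spanned_def by blast
  then have "tens (a + b) =
      tens ((\<Sum>i<6. const (c i) * std_word i) + (\<Sum>i<6. const (d i) * std_word i))"
    by (rule tens_add_cong)
  also have "(\<Sum>i<6. const (c i) * std_word i) + (\<Sum>i<6. const (d i) * std_word i) =
      (\<Sum>i<6. const (c i + d i) * std_word i)"
    by (simp only: const_add[symmetric] distrib_right sum.distrib)
  finally show ?thesis unfolding spanned_def by (intro CollectI exI[of _ "\<lambda>i. c i + d i"])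
qed

lemma spanned_scale:
  assumes "a \<in> spanned"
  shows "const k * a \<in> spanned"
proof -
  obtain c where "tens a = tens (\<Sum>i<6. const (c i) * std_word i)"
    using assms unfolding spanned_def by blast
  then have "tens (const k * a) = tens (const k * (\<Sum>i<6. const (c i) * std_word i))"
    by (rule tens_mult_cong)
  also have "const k * (\<Sum>i<6. const (c i) * std_word i) = (\<Sum>i<6. const (k * c i) * std_word i)"
    by (simp only: sum_distrib_left const_mult[symmetric] mult.assoc)
  finally show ?thesis unfolding spanned_def by (intro CollectI exI[of _ "\<lambda>i. k * c i"])
qed

lemma spanned_std_word: "i < 6 \<Longrightarrow> std_word i \<in> spanned"
proof -
  assume "i < 6"
  then have "std_word i = (\<Sum>j<6. const (of_bool (i = j)) * std_word j)"
    by (simp add: of_bool_def if_distrib[of const] const_one const_zero if_distribR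
        if_distrib[of "\<lambda>x. x * _"] sum.delta cong: if_cong)
  then show ?thesis
    unfolding spanned_def by (intro CollectI exI[of _ "\<lambda>j. of_bool (i = j)"]) simp
qed

lemma spanned_zero: "0 \<in> spanned"
  using spanned_scale[OF spanned_std_word[of 0], of 0] by (simp add: const_zero)

lemma spanned_sum: "(\<And>i. i \<in> A \<Longrightarrow> f i \<in> spanned) \<Longrightarrow> sum f A \<in> spanned"
  by (induction A rule: infinite_finite_induct) (auto simp: spanned_zero spanned_add)

lemma spanned_mult:
  assumes g: "\<And>i. i < 6 \<Longrightarrow> g * std_word i \<in> spanned" and a: "a \<in> spanned"
  shows "g * a \<in> spanned"
proof -
  obtain c where c: "tens a = tens (\<Sum>i<6. const (c i) * std_word i)"
    using a unfolding spanned_def by blast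
  have "g * (\<Sum>i<6. const (c i) * std_word i) = (\<Sum>i<6. const (c i) * (g * std_word i))"
    unfolding sum_distrib_left by (rule sum.cong[OF refl]) (metis const_commute mult.assoc)
  also have "\<dots> \<in> spanned" by (intro spanned_sum spanned_scale g) simp
  finally show ?thesis using spanned_cong[OF tens_mult_cong[OF c]] by blast
qed

lemma spanned_T_back:
  assumes "i < 5"
  defines "j \<equiv> if even i then N2 else N1"
  shows "gen (GenT j) * std_word (Suc i) \<in> spanned"
proof -
  have "gen (GenT j) * gen (GenT j) - (const (q - inverse q) * gen (GenT j) + 1) \<in> hecke_rels q"
    unfolding hecke_rels_def by blast
  from tens_rel[OF this, of "std_word i"]
  have "tens (gen (GenT j) * std_word (Suc i)) =
      tens (const (q - inverse q) * std_word (Suc i) + std_word i)"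
    by (simp add: j_def mult.assoc distrib_right)
  moreover have "const (q - inverse q) * std_word (Suc i) + std_word i \<in> spanned"
    using assms(1) by (intro spanned_add spanned_scale spanned_std_word) auto
  ultimately show ?thesis by (rule spanned_cong)
qed

lemma spanned_T_forward: "i < 5 \<Longrightarrow> gen (GenT (if even i then N2 else N1)) * std_word i \<in> spanned"
  using spanned_std_word[of "Suc i"] by simp

lemma std_word_5:
  "std_word 5 = gen (GenT N2) * (gen (GenT N1) * (gen (GenT N2) * (gen (GenT N1) * gen (GenT N2))))"
proof -
  have "std_word 2 = gen (GenT N1) * gen (GenT N2)" by (simp add: numeral_2_eq_2)
  then show ?thesis
    using std_word.simps(2)[of 2] std_word.simps(2)[of 3] std_word.simps(2)[of 4]
    by (simp del: std_word.simps)
qed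

lemma spanned_T: "a \<in> spanned \<Longrightarrow> gen (GenT j) * a \<in> spanned"
proof (rule spanned_mult)
  let ?t1 = "gen (GenT N1)" and ?t2 = "gen (GenT N2)"
  have T1_0: "?t1 * std_word 0 \<in> spanned"
  proof (rule spanned_cong)
    show "tens (?t1 * std_word 0) = tens (const q * std_word 0)"
      using tens_eigen[OF eigenvalue_T1] by simp
    show "const q * std_word 0 \<in> spanned" by (intro spanned_scale spanned_std_word) simp
  qed
  have T1_5: "?t1 * std_word 5 \<in> spanned"
  proof (rule spanned_cong)
    have "?t1 * ?t2 * ?t1 * ?t2 * ?t1 * ?t2 - ?t2 * ?t1 * ?t2 * ?t1 * ?t2 * ?t1 \<in> hecke_rels q"
      unfolding hecke_rels_def by blast
    \<comment> \<open>The braid relation moves \<open>T\<^sub>1\<close> to the right end of the word, where it acts on \<open>v\<close> by \<open>q\<close>.\<close>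
    from tens_rel[OF this, of 1] have "tens (?t1 * std_word 5) = tens (std_word 5 * ?t1)"
      by (simp add: std_word_5 mult.assoc)
    also have "\<dots> = tens (std_word 5 * const q)"
      by (rule tens_mult_cong[OF tens_eigen[OF eigenvalue_T1]])
    finally show "tens (?t1 * std_word 5) = tens (const q * std_word 5)"
      by (simp only: const_commute)
    show "const q * std_word 5 \<in> spanned" by (intro spanned_scale spanned_std_word) simp
  qed
  fix i :: nat assume "i < 6"
  show "gen (GenT j) * std_word i \<in> spanned"
  proof (cases "j = (if even i then N2 else N1)")
    case True
    then show ?thesis
      using \<open>i < 6\<close> T1_5 spanned_T_forward[of i] by (cases "i = 5") (simp_all del: std_word.simps)
  next
    case False
    show ?thesis
    proof (cases i)
      case 0
      then have "j = N1" using False by (cases j) simp_all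
      then show ?thesis using T1_0 0 by simp
    next
      case (Suc k)
      then have "j = (if even k then N2 else N1)" using False by (cases j) (auto split: if_splits)
      then show ?thesis using spanned_T_back[of k] Suc \<open>i < 6\<close> by (simp del: std_word.simps)
    qed
  qed
qed

text \<open>By induction on the length of \<open>w\<close>: the Bernstein relation moves \<open>X\<^sup>l\<close> past the first letter of \<open>T\<^sub>w\<close> and leaves
powers of \<open>X\<close> in front of a shorter word.\<close>

lemma spanned_X: "a \<in> spanned \<Longrightarrow> gen (GenX l) * a \<in> spanned"
proof (rule spanned_mult)
  fix i :: nat assume "i < 6"
  then show "gen (GenX l) * std_word i \<in> spanned"
  proof (induction i arbitrary: l)
    case 0
    have "tens (gen (GenX l) * std_word 0) = tens (const (weight l) * std_word 0)"
      using tens_eigen[OF eigenvalue_X] by simp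
    then show ?case
      by (rule spanned_cong) (intro spanned_scale spanned_std_word, simp)
  next
    case (Suc i)
    define j where "j = (if even i then N2 else N1)"
    obtain f where "is_bernstein_quotient j l f" using bernstein_quotient_exists by blast
    then have "gen (GenX l) * gen (GenT j) - (gen (GenT j) * gen (GenX (simple_refl j l)) +
        const (q - inverse q) * of_group_alg f) \<in> hecke_rels q"
      unfolding hecke_rels_def by blast
    from tens_rel[OF this, of "std_word i"]
    have "tens (gen (GenX l) * std_word (Suc i)) =
        tens (gen (GenT j) * (gen (GenX (simple_refl j l)) * std_word i) +
          const (q - inverse q) * (of_group_alg f * std_word i))"
      by (simp add: j_def mult.assoc distrib_right)
    moreover have "of_group_alg f * std_word i \<in> spanned"
      using Suc unfolding of_group_alg_def sum_distrib_right mult.assoc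
      by (intro spanned_sum spanned_scale) simp
    ultimately show ?case
      using Suc by (elim spanned_cong) (intro spanned_add spanned_T spanned_scale, simp_all)
  qed
qed

lemma spanned_all: "a \<in> spanned"
proof (induction a rule: poly_mapping_additive_induct)
  case (single w c)
  have "Poly_Mapping.single (Word gs) 1 \<in> spanned" for gs
  proof (induction gs)
    case Nil
    have "Poly_Mapping.single (Word []) (1 :: complex) = std_word 0"
      by (simp flip: zero_word_def)
    then show ?case using spanned_std_word[of 0] by simp
  next
    case (Cons g gs)
    have "Poly_Mapping.single (Word (g # gs)) 1 = gen g * Poly_Mapping.single (Word gs) 1"
      by (simp add: gen_def mult_single plus_word_def)
    then show ?case using Cons spanned_T spanned_X by (cases g) auto
  qed
  moreover have "Poly_Mapping.single w c = const c * Poly_Mapping.single (Word (letters w)) 1"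
    by (simp add: const_def mult_single)
  ultimately show ?case by (simp only: spanned_scale)
qed (simp_all add: spanned_zero spanned_add)

section \<open>Irreducibility\<close>

lemma tens_diff_zero: "tens (a - b) = \<zero>\<^bsub>ind.M\<^esub> \<longleftrightarrow> tens a = tens b"
proof
  interpret M: abelian_group ind.M by (rule ind.abelian_group_M)
  have closed: "tens a \<in> carrier ind.M" for a by (simp add: tens_def ind.pure_closed)
  show "tens a = tens b" if "tens (a - b) = \<zero>\<^bsub>ind.M\<^esub>"
    using tens_add[of "a - b" b] that closed by simp
  show "tens (a - b) = \<zero>\<^bsub>ind.M\<^esub>" if "tens a = tens b"
  proof -
    have "tens (a - b) \<oplus>\<^bsub>ind.M\<^esub> tens b = tens b"
      using tens_add[of "a - b" b] that by simp
    then show ?thesis by (simp only: M.add.r_cancel_one closed)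
  qed
qed

text \<open>Only the direction from right to left needs the spanning set: a combination of the six spanning tensors goes to
the combination of the unit vectors with the same coefficients up to sign, so it is zero if its image is.\<close>

lemma tens_eq_zero_iff: "tens a = \<zero>\<^bsub>ind.M\<^esub> \<longleftrightarrow> rep a (ops.unit_vec 0) = 0"
proof
  show "rep a (ops.unit_vec 0) = 0" if "tens a = \<zero>\<^bsub>ind.M\<^esub>"
    using that rep_zero_if_pure_zero by (simp add: tens_def)
next
  assume rep: "rep a (ops.unit_vec 0) = 0"
  obtain c where c: "tens a = tens (\<Sum>i<6. const (c i) * std_word i)"
    using spanned_all[of a] unfolding spanned_def by blast
  then have "rep (a - (\<Sum>i<6. const (c i) * std_word i)) (ops.unit_vec 0) = 0"
    by (intro rep_zero_if_pure_zero) (simp add: tens_diff_zero flip: tens_def)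
  then have "(\<Sum>i<6. vscale (c i * \<epsilon> ^ i) (ops.unit_vec i)) = 0"
    using rep by (simp add: rep_diff rep_sum rep_mult rep_const rep_std_word vscale_vscale)
  then have "\<forall>i<6. c i * \<epsilon> ^ i = 0"
    unfolding ops.less_6 by (simp add: eval_nat_numeral ops.unit_vec_def vscale_def zero_prod_def)
  then have "\<forall>i<6. c i = 0" using eps by auto
  then have "(\<Sum>i<6. const (c i) * std_word i) = 0" by (simp add: const_zero)
  then show "tens a = \<zero>\<^bsub>ind.M\<^esub>" using c tens_zero by simp
qed

lemma irreducible_induced:
  assumes "z ^ 2 \<noteq> 1" "z ^ 5 \<noteq> 1"
  shows "irreducible_module H ind.M"
proof (rule ind.irreducibleI)
  have one: "ind.pure \<one>\<^bsub>H\<^esub> = tens 1" by (simp add: tens_def hecke_class_one)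
  show "ind.pure \<one>\<^bsub>H\<^esub> \<noteq> \<zero>\<^bsub>ind.M\<^esub>"
    unfolding one tens_eq_zero_iff by (simp add: rep_one ops.unit_vec_def zero_prod_def)
  fix r assume "r \<in> carrier H" "ind.pure r \<noteq> \<zero>\<^bsub>ind.M\<^esub>"
  then obtain a where "r = cl a" "tens a \<noteq> \<zero>\<^bsub>ind.M\<^esub>"
    unfolding carrier_affine_hecke tens_def by blast
  then have a: "r = cl a" "rep a (ops.unit_vec 0) \<noteq> 0" unfolding tens_eq_zero_iff .
  obtain b where "rep b (rep a (ops.unit_vec 0)) = ops.unit_vec 0" using generate_unit_vec[OF a(2) assms] ..
  then have "tens (b * a - 1) = \<zero>\<^bsub>ind.M\<^esub>"
    by (simp add: tens_eq_zero_iff rep_diff rep_mult rep_one)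
  then have "ind.pure (cl b \<otimes>\<^bsub>H\<^esub> r) = ind.pure \<one>\<^bsub>H\<^esub>"
    by (simp add: one a(1) tens_diff_zero) (simp add: tens_def hecke_class_mult)
  then show "\<exists>b\<in>carrier H. ind.pure (b \<otimes>\<^bsub>H\<^esub> r) = ind.pure \<one>\<^bsub>H\<^esub>" by (rule bexI[OF _ hecke_class_closed])
qed

end

theorem proposition30:
  fixes q \<epsilon> :: complex
    and t t' :: "int \<times> int \<Rightarrow> complex"
    and V :: "(free_alg set, 'v) module" and v :: 'v
    and W :: "(free_alg set, 'w) module" and w :: 'w
  assumes "q \<noteq> 0" and "q\<^sup>2 \<noteq> 1"
    and "\<epsilon> \<in> {1, -1}"
    and "t' = weight_of (\<epsilon> * q) 1"
    and "t = weyl_act (simple_refl N2 \<circ> simple_refl N1) t'"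
    and "is_weight_line q N1 q t V v"
    and "is_weight_line q N1 (- inverse q) (weyl_act weyl_w0 t) W w"
    and "t' (simple_root N1) \<noteq> q powi (-2)"
    and "t' (lat_scale 3 (simple_root N1)) \<noteq> q powi (-2)"
  shows "irreducible_module (affine_hecke q)
           (induced_module (affine_hecke q) (hecke_sub q N1) V)
       \<and> irreducible_module (affine_hecke q)
           (induced_module (affine_hecke q) (hecke_sub q N1) W)"
proof
  define z where "z = \<epsilon> * q"
  have e: "\<epsilon> * \<epsilon> = 1" "inverse \<epsilon> = \<epsilon>" using assms(3) by auto
  have z2: "z ^ 2 = q ^ 2" using e by (simp add: z_def power_mult_distrib power2_eq_square)
  have t: "t l = z powi (2 * fst l - 3 * snd l)" for l
    unfolding assms(4,5)
    by (cases l) (simp add: weyl_act_def o_inv_distrib bij_simple_refl simple_refl_N1 simple_refl_N2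
        weight_of_def z_def algebra_simps)
  have z5: "z ^ 5 \<noteq> 1"
  proof
    assume "z ^ 5 = 1"
    \<comment> \<open>\<open>z\<^sup>3 = t'(X\<^bsup>3\<alpha>\<^sub>1\<^esup>)\<close> and \<open>z\<^sup>2 = q\<^sup>2\<close>.\<close>
    then have "z ^ 3 * q ^ 2 = 1" by (simp flip: z2 power_add)
    then have "z ^ 3 = inverse (q ^ 2)" using assms(1) by (simp add: field_simps)
    then show False
      using assms(9) by (simp add: assms(4) lat_scale_def weight_of_def power_int_minus flip: z_def)
  qed
  have "irreducible_module (affine_hecke q) (induced_module (affine_hecke q) (hecke_sub q N1) V)"
  proof -
    interpret g2_representation q \<epsilon> by unfold_locales (use assms in auto)
    have "t = weight" by (rule ext) (simp add: t weight_def z_def)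
    then interpret g2_induced_module q \<epsilon> V v by unfold_locales (use assms(6) in simp)
    show ?thesis using irreducible_induced assms(2) z2 z5 by (simp add: z_def)
  qed
  then show "irreducible_module (affine_hecke q) (induced_module (affine_hecke q) (hecke_sub q N1) V)" .
  show "irreducible_module (affine_hecke q) (induced_module (affine_hecke q) (hecke_sub q N1) W)"
  proof -
    \<comment> \<open>The other root of the quadratic relation: it defines the same algebra.\<close>
    define p where "p = - inverse q"
    have "p - inverse p = q - inverse q" by (simp add: p_def)
    then have "hecke_rels p = hecke_rels q" by (simp only: hecke_rels_def)
    then have cl: "hecke_class p = hecke_class q" and H: "affine_hecke p = affine_hecke q"
      by (simp_all add: hecke_class_def[abs_def] affine_hecke_def hecke_ideal_def)
    then have S: "hecke_sub p = hecke_sub q" by (simp add: hecke_sub_def[abs_def])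
    interpret g2_representation p "- \<epsilon>" by unfold_locales (use assms in \<open>auto simp: p_def\<close>)
    have zi: "- \<epsilon> * p = inverse z" using e by (simp add: p_def z_def)
    have "inv_into UNIV weyl_w0 l = - l" for l
      by (rule inv_into_f_eq) (auto simp: inj_def weyl_w0_eq)
    then have "weyl_act weyl_w0 t = weight"
      unfolding weyl_act_def weight_def zi by (simp add: fun_eq_iff t power_int_inverse flip: power_int_minus)
    then have "is_weight_line q N1 p weight W w" using assms(7) unfolding p_def by simp
    moreover have "is_weight_line p N1 p weight W w \<longleftrightarrow> is_weight_line q N1 p weight W w"
      by (simp only: is_weight_line_def cl S)
    ultimately interpret g2_induced_module p "- \<epsilon>" W w by unfold_locales simp
    have "(inverse z) ^ 2 \<noteq> 1" "(inverse z) ^ 5 \<noteq> 1"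
      using assms(2) z2 z5 by (simp_all add: power_inverse)
    then show ?thesis using irreducible_induced unfolding zi H S by simp
  qed
qed

end
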